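(* Suppose $\alpha$ is a symmetric weak composition with $\alpha_1=0$. Then $\kappa^{\mathsf Q}_\alpha=2^{\mathsf{diag}(\alpha)}\,\kappa^{\mathsf P}_{\eta(\alpha)}$.
   Context: Let $\mathbb P=\{1,2,3,\dots\}$. $S_\infty$ is the group of permutations of $\mathbb P$ generated by $s_i=(i\;\,i+1)$; it acts on $\mathbb Z[x_1,x_2,\dots]$ by permuting variables. Define $\pi_i f=(x_if-x_{i+1}s_if)/(x_i-x_{i+1})$; these satisfy the braid relations, so $\pi_w=\pi_{i_1}\cdots\pi_{i_l}$ is well-defined for any reduced word $i_1\cdots i_l$ of $w\in S_\infty$. A weak composition is a sequence $\alpha=(\alpha_1,\alpha_2,\dots)$ of nonnegative integers with finite sum. A partition is a weakly decreasing weak composition; it is strict if its nonzero parts are distinct. $S_\infty$ acts by $w\alpha=(\alpha_{w^{-1}(1)},\alpha_{w^{-1}(2)},\dots)$. Let $\lambda(\alpha)$ be the partition sorting $\alpha$ and $u(\alpha)$ the minimal-length $u\in S_\infty$ with $\alpha=u\lambda(\alpha)$. Let $\mathsf D_\mu=\{(i,j)\in\mathbb P\times\mathbb P:1\le j\le\mu_i\}$. For $w\in S_\infty$ and strict $\mu$: $\kappa^{\mathsf P}_{w,\mu}=\pi_w\prod_{(i,j)\in\mathsf D_\mu}(x_i+x_{i+j})$ and $\kappa^{\mathsf Q}_{w,\mu}=\pi_w\prod_{(i,j)\in\mathsf D_\mu}(x_i+x_{i+j-1})$. A partition $\lambda$ is symmetric if $\lambda=\lambda^{\mathsf T}$; a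 weak composition $\alpha$ is symmetric if $\lambda(\alpha)$ is. For a symmetric partition $\lambda$, $\mathrm{half}_<(\lambda)$ and $\mathrm{half}_\le(\lambda)$ are the strict partitions with nonzero parts $\{\lambda_i-i:i\in\mathbb P\}\cap\mathbb P$ and $\{\lambda_i-(i-1):i\in\mathbb P\}\cap\mathbb P$. For a symmetric weak composition $\alpha$: $\kappa^{\mathsf P}_\alpha=\kappa^{\mathsf P}_{u(\alpha),\mathrm{half}_<(\lambda(\alpha))}$ and $\kappa^{\mathsf Q}_\alpha=\kappa^{\mathsf Q}_{u(\alpha),\mathrm{half}_\le(\lambda(\alpha))}$. An addable (removable) corner of a partition is a cell that can be added to (removed from) its Young diagram so that the result is again the Young diagram of a partition. A partition $\lambda$ is skew-symmetric if $\lambda=\lambda^{\mathsf T}$ and, for every $i$: if $(i,i)$ is a removable corner then $(i,i+1)$ is not an addable corner, and if $(i,i)$ is an addable corner then $(i,i-1)$ is not a removable corner. A weak composition $\alpha$ is skew-symmetric if $\lambda(\alpha)$ is. For a symmetric weak composition $\alpha$ with $u=u(\alpha)$, $\lambda=\lambda(\alpha)$ let $\mathsf D^{\mathsf{sym}}_\alpha=\{(u(i),u(j)):(i,j)\in\mathsf D_\lambda\}$ (so $\alpha_i$ is the number of its positions in row $i$) and $\mathsf{diag}(\alpha)=|\{(i,j)\in\mathsf D^{\mathsf{sym}}_\alpha:i=j\}|$. If $\alpha$ is symmetric with $\alpha_1=0$, there are symmetric weak compositions $\eta^{(1)},\eta^{(2)}$ determined by $$\mathsf D^{\mathsf{sym}}_{\eta^{(1)}}=\mathsf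 D^{\mathsf{sym}}_\alpha\sqcup\{(i,j): i=1\text{ and }(j,j)\in\mathsf D^{\mathsf{sym}}_\alpha,\text{ or }j=1\text{ and }(i,i)\in\mathsf D^{\mathsf{sym}}_\alpha\},\qquad \mathsf D^{\mathsf{sym}}_{\eta^{(2)}}=\mathsf D^{\mathsf{sym}}_{\eta^{(1)}}\sqcup\{(1,1)\}.$$ Exactly one of $\eta^{(1)},\eta^{(2)}$ is skew-symmetric, and $\eta(\alpha)$ denotes that one. *)

theory Defs
  imports "HOL-Library.Poly_Mapping" "HOL-Combinatorics.Transposition"
begin

text \<open>
  Index convention: the index set is the set of positive integers, rendered as the nonzero
  elements of \<^typ>\<open>nat\<close>.  Weak compositions are functions on \<^typ>\<open>nat\<close> that vanish at the unused
  index 0, permutations in \<open>S_inf\<close> fix 0, and the variable with index 0 never occurs below.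
\<close>

definition adj_transp :: "nat \<Rightarrow> nat \<Rightarrow> nat" where
  "adj_transp i = transpose i (i + 1)"

definition is_word :: "nat list \<Rightarrow> bool" where
  "is_word is \<longleftrightarrow> (\<forall>i\<in>set is. 1 \<le> i)"

definition word_perm :: "nat list \<Rightarrow> nat \<Rightarrow> nat" where
  "word_perm is = foldr (\<lambda>i w. adj_transp i \<circ> w) is id"

text \<open>The generators are involutions, so the group they generate consists of the products of words.\<close>

definition S_inf :: "(nat \<Rightarrow> nat) set" where
  "S_inf = {word_perm is |is. is_word is}"

definition perm_length :: "(nat \<Rightarrow> nat) \<Rightarrow> nat" where
  "perm_length w = (LEAST l. \<exists>is. is_word is \<and> word_perm is = w \<and> length is = l)"

definition reduced_word :: "nat list \<Rightarrow> (nat \<Rightarrow> nat) \<Rightarrow> bool" where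
  "reduced_word is w \<longleftrightarrow> is_word is \<and> word_perm is = w \<and> length is = perm_length w"

type_synonym ipoly = "(nat \<Rightarrow>\<^sub>0 nat) \<Rightarrow>\<^sub>0 int"

definition X :: "nat \<Rightarrow> ipoly" where
  "X i = Poly_Mapping.single (Poly_Mapping.single i 1) 1"

text \<open>
  The coefficient of the monomial with exponents \<open>m\<close> in \<open>perm_poly w f\<close> is the coefficient in
  \<open>f\<close> of the monomial with exponents \<open>i \<mapsto> m (w i)\<close>; that is, \<open>X i\<close> is sent to \<open>X (w i)\<close>.
\<close>

definition perm_poly :: "(nat \<Rightarrow> nat) \<Rightarrow> ipoly \<Rightarrow> ipoly" where
  "perm_poly w f = Poly_Mapping.map_key (Poly_Mapping.map_key w) f"

lemma perm_poly_X:
  assumes "bij w"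
  shows "perm_poly w (X i) = X (w i)"
proof -
  have w: "inj w" using assms by (simp add: bij_is_inj)
  have inj: "inj (Poly_Mapping.map_key w :: (nat \<Rightarrow>\<^sub>0 nat) \<Rightarrow> _)"
  proof (rule injI)
    fix p q :: "nat \<Rightarrow>\<^sub>0 nat"
    assume "Poly_Mapping.map_key w p = Poly_Mapping.map_key w q"
    then have "Poly_Mapping.lookup p (w j) = Poly_Mapping.lookup q (w j)" for j
      by (metis (no_types) map_key.rep_eq[OF w] comp_apply)
    then show "p = q"
      by (intro poly_mapping_eqI) (metis assms bij_pointE)
  qed
  have "Poly_Mapping.single i 1 = Poly_Mapping.map_key w (Poly_Mapping.single (w i) (1::nat))"
    using map_key_single[OF w, of i "1::nat"] by simp
  then show ?thesis
    unfolding perm_poly_def X_def using map_key_single[OF inj] by metis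
qed

definition idd :: "nat \<Rightarrow> ipoly \<Rightarrow> ipoly" where
  "idd i f = (THE g. (X i - X (i + 1)) * g
                     = X i * f - X (i + 1) * perm_poly (adj_transp i) f)"

text \<open>By the braid relations the choice of the reduced word is immaterial.\<close>

definition idd_perm :: "(nat \<Rightarrow> nat) \<Rightarrow> ipoly \<Rightarrow> ipoly" where
  "idd_perm w f = foldr idd (SOME is. reduced_word is w) f"

definition weak_composition :: "(nat \<Rightarrow> nat) \<Rightarrow> bool" where
  "weak_composition \<alpha> \<longleftrightarrow> \<alpha> 0 = 0 \<and> finite {i. \<alpha> i \<noteq> 0}"

definition is_partition :: "(nat \<Rightarrow> nat) \<Rightarrow> bool" where
  "is_partition \<mu> \<longleftrightarrow> weak_composition \<mu> \<and> (\<forall>i j. 1 \<le> i \<and> i \<le> j \<longrightarrow> \<mu> j \<le> \<mu> i)"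

definition strict_partition :: "(nat \<Rightarrow> nat) \<Rightarrow> bool" where
  "strict_partition \<mu> \<longleftrightarrow> is_partition \<mu> \<and> inj_on \<mu> {i. \<mu> i \<noteq> 0}"

definition act :: "(nat \<Rightarrow> nat) \<Rightarrow> (nat \<Rightarrow> nat) \<Rightarrow> nat \<Rightarrow> nat" where
  "act w \<alpha> = (\<lambda>i. \<alpha> (inv w i))"

definition sort_part :: "(nat \<Rightarrow> nat) \<Rightarrow> nat \<Rightarrow> nat" where
  "sort_part \<alpha> = (THE \<mu>. is_partition \<mu> \<and> (\<exists>w\<in>S_inf. \<alpha> = act w \<mu>))"

definition sort_perm :: "(nat \<Rightarrow> nat) \<Rightarrow> nat \<Rightarrow> nat" where
  "sort_perm \<alpha> = (ARG_MIN perm_length u. u \<in> S_inf \<and> \<alpha> = act u (sort_part \<alpha>))"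

definition diagram :: "(nat \<Rightarrow> nat) \<Rightarrow> (nat \<times> nat) set" where
  "diagram \<mu> = {(i, j). 1 \<le> i \<and> 1 \<le> j \<and> j \<le> \<mu> i}"

definition transpose_part :: "(nat \<Rightarrow> nat) \<Rightarrow> nat \<Rightarrow> nat" where
  "transpose_part \<mu> j = (if j = 0 then 0 else card {i. 1 \<le> i \<and> j \<le> \<mu> i})"

definition symmetric_partition :: "(nat \<Rightarrow> nat) \<Rightarrow> bool" where
  "symmetric_partition \<mu> \<longleftrightarrow> is_partition \<mu> \<and> \<mu> = transpose_part \<mu>"

definition symmetric_wc :: "(nat \<Rightarrow> nat) \<Rightarrow> bool" where
  "symmetric_wc \<alpha> \<longleftrightarrow> weak_composition \<alpha> \<and> symmetric_partition (sort_part \<alpha>)"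

text \<open>
  In the next two definitions a difference that is not positive is truncated to 0, and 0 is then
  removed from the set of parts.
\<close>

definition half_lt :: "(nat \<Rightarrow> nat) \<Rightarrow> nat \<Rightarrow> nat" where
  "half_lt l = (THE \<mu>. strict_partition \<mu> \<and> range \<mu> - {0} = {l i - i |i. 1 \<le> i} - {0})"

definition half_le :: "(nat \<Rightarrow> nat) \<Rightarrow> nat \<Rightarrow> nat" where
  "half_le l = (THE \<mu>. strict_partition \<mu> \<and> range \<mu> - {0} = {l i - (i - 1) |i. 1 \<le> i} - {0})"

definition kappaP_pair :: "(nat \<Rightarrow> nat) \<Rightarrow> (nat \<Rightarrow> nat) \<Rightarrow> ipoly" where
  "kappaP_pair w \<mu> = idd_perm w (\<Prod>(i, j)\<in>diagram \<mu>. X i + X (i + j))"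

definition kappaQ_pair :: "(nat \<Rightarrow> nat) \<Rightarrow> (nat \<Rightarrow> nat) \<Rightarrow> ipoly" where
  "kappaQ_pair w \<mu> = idd_perm w (\<Prod>(i, j)\<in>diagram \<mu>. X i + X (i + j - 1))"

definition kappaP :: "(nat \<Rightarrow> nat) \<Rightarrow> ipoly" where
  "kappaP \<alpha> = kappaP_pair (sort_perm \<alpha>) (half_lt (sort_part \<alpha>))"

definition kappaQ :: "(nat \<Rightarrow> nat) \<Rightarrow> ipoly" where
  "kappaQ \<alpha> = kappaQ_pair (sort_perm \<alpha>) (half_le (sort_part \<alpha>))"

definition addable_corner :: "(nat \<Rightarrow> nat) \<Rightarrow> nat \<times> nat \<Rightarrow> bool" where
  "addable_corner \<mu> c \<longleftrightarrow>
     c \<notin> diagram \<mu> \<and> (\<exists>\<nu>. is_partition \<nu> \<and> diagram \<nu> = insert c (diagram \<mu>))"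

definition removable_corner :: "(nat \<Rightarrow> nat) \<Rightarrow> nat \<times> nat \<Rightarrow> bool" where
  "removable_corner \<mu> c \<longleftrightarrow>
     c \<in> diagram \<mu> \<and> (\<exists>\<nu>. is_partition \<nu> \<and> diagram \<nu> = diagram \<mu> - {c})"

text \<open>For \<open>i = 1\<close> the pair \<open>(i, i - 1)\<close> is not a cell, hence never a removable corner.\<close>

definition skew_symmetric_partition :: "(nat \<Rightarrow> nat) \<Rightarrow> bool" where
  "skew_symmetric_partition \<mu> \<longleftrightarrow> symmetric_partition \<mu> \<and>
     (\<forall>i\<ge>1. (removable_corner \<mu> (i, i) \<longrightarrow> \<not> addable_corner \<mu> (i, i + 1)) \<and>
            (addable_corner \<mu> (i, i) \<longrightarrow> \<not> removable_corner \<mu> (i, i - 1)))"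

definition skew_symmetric_wc :: "(nat \<Rightarrow> nat) \<Rightarrow> bool" where
  "skew_symmetric_wc \<alpha> \<longleftrightarrow> weak_composition \<alpha> \<and> skew_symmetric_partition (sort_part \<alpha>)"

definition Dsym :: "(nat \<Rightarrow> nat) \<Rightarrow> (nat \<times> nat) set" where
  "Dsym \<alpha> = {(sort_perm \<alpha> i, sort_perm \<alpha> j) |i j. (i, j) \<in> diagram (sort_part \<alpha>)}"

definition diag :: "(nat \<Rightarrow> nat) \<Rightarrow> nat" where
  "diag \<alpha> = card {(i, j) \<in> Dsym \<alpha>. i = j}"

definition eta1 :: "(nat \<Rightarrow> nat) \<Rightarrow> nat \<Rightarrow> nat" where
  "eta1 \<alpha> = (THE \<eta>. symmetric_wc \<eta> \<and>
     Dsym \<eta> = Dsym \<alpha> \<union> {(i, j). (i = 1 \<and> (j, j) \<in> Dsym \<alpha>) \<or> (j = 1 \<and> (i, i) \<in> Dsym \<alpha>)})"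

definition eta2 :: "(nat \<Rightarrow> nat) \<Rightarrow> nat \<Rightarrow> nat" where
  "eta2 \<alpha> = (THE \<eta>. symmetric_wc \<eta> \<and> Dsym \<eta> = Dsym (eta1 \<alpha>) \<union> {(1, 1)})"

definition eta :: "(nat \<Rightarrow> nat) \<Rightarrow> nat \<Rightarrow> nat" where
  "eta \<alpha> = (THE \<eta>. \<eta> \<in> {eta1 \<alpha>, eta2 \<alpha>} \<and> skew_symmetric_wc \<eta>)"

end

theory Submission
  imports Defs
begin

text \<open>
  Write \<open>l\<close> for the sorted partition of \<open>\<alpha>\<close>, \<open>d\<close> for the number of its diagonal cells,
  \<open>u\<close> for \<open>sort_perm \<alpha>\<close> and \<open>n = l 1\<close>, which is also the number of nonzero parts. The
  sorted partition of \<open>eta \<alpha>\<close> is \<open>l\<close> with one row and one column of length \<open>d\<close> or \<open>d + 1\<close>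
  inserted behind the first \<open>d\<close>, and its \<open>half_lt\<close> is the \<open>half_le\<close> of \<open>l\<close>. So both sides
  are built from one strict partition, and they differ in the product and in the permutation.

  The permutations have a common part. As \<open>\<alpha> 1 = 0\<close>, the index 1 is the first one that \<open>u\<close>
  puts behind the nonzero parts, so \<open>u = v s\<^sub>1 \<dots> s\<^sub>n\<close> with \<open>v 1 = 1\<close> and with lengths adding up.
  In \<open>eta \<alpha>\<close> the index 1 carries the new part, which stands behind \<open>t = l (d + 1)\<close> others, so
  \<open>sort_perm (eta \<alpha>) = v s\<^sub>1 \<dots> s\<^sub>t\<close>. The skew-symmetric choice between \<open>d\<close> and \<open>d + 1\<close> is
  exactly what makes the second formula true. It remains to prove
  \<open>\<pi>\<^sub>1 \<dots> \<pi>\<^sub>n Q = 2\<^sup>d \<pi>\<^sub>1 \<dots> \<pi>\<^sub>t P\<close> for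
  \<open>Q = (\<Prod>i\<le>d. \<Prod>i\<le>b\<le>l i. x\<^sub>i + x\<^sub>b)\<close> and \<open>P = (\<Prod>i\<le>d. \<Prod>i<b\<le>l i + 1. x\<^sub>i + x\<^sub>b)\<close>.

  The rows \<open>t < i \<le> d\<close> of \<open>l\<close> all have length \<open>d\<close>, hence \<open>P\<close> is symmetric in
  \<open>x\<^sub>t\<^sub>+\<^sub>1, \<dots>, x\<^sub>d\<^sub>+\<^sub>1\<close> (\<open>swap_vars_prows\<close>), and \<open>t\<close> may be replaced by \<open>d\<close>. The factors with
  \<open>b = i\<close> give \<open>Q = 2\<^sup>d Q'\<close>, where \<open>Q'\<close> has \<open>x\<^sub>i\<close> in place of \<open>2 x\<^sub>i\<close>. The identity
  \<open>\<pi>\<^sub>1 \<dots> \<pi>\<^sub>n Q' = \<pi>\<^sub>1 \<dots> \<pi>\<^sub>d P\<close> is \<open>idds_qrows\<close>. It is proved by removing the first row; the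
  error term of this step vanishes by \<open>dds_row_qrows\<close>, a statement on ordinary divided
  differences in which the braid relation is decisive.

  All this uses that \<open>\<pi>\<^sub>w\<close> can be computed from any reduced word
  (\<open>foldr_idd_reduced_word_unique\<close>), and that \<open>sort_perm\<close>, defined by minimal length, is the
  unique sorting permutation that keeps equal parts in order (\<open>sort_perm_eqI\<close>).
\<close>

section \<open>The action of permutations on polynomials\<close>

lemma update_eq_add_single:
  fixes g :: "'x \<Rightarrow>\<^sub>0 'y::monoid_add"
  assumes "a \<notin> Poly_Mapping.keys g"
  shows "Poly_Mapping.update a b g = g + Poly_Mapping.single a b"
  using assms
  by (intro poly_mapping_eqI)
     (auto simp: lookup_update lookup_add lookup_single when_def in_keys_iff)

lemma ipoly_induct [case_names const X add mult]:
  fixes f :: ipoly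
  assumes const: "\<And>c. P (of_int c)"
    and X: "\<And>i. P (X i)"
    and add: "\<And>f g. P f \<Longrightarrow> P g \<Longrightarrow> P (f + g)"
    and mult: "\<And>f g. P f \<Longrightarrow> P g \<Longrightarrow> P (f * g)"
  shows "P f"
proof -
  have P1: "P 1" using const[of 1] by simp
  have monom_var: "P (Poly_Mapping.single (Poly_Mapping.single i k) 1)" for i k
  proof (induction k)
    case 0
    then show ?case using P1 by simp
  next
    case (Suc k)
    have "Poly_Mapping.single (Poly_Mapping.single i (Suc k)) 1
        = X i * (Poly_Mapping.single (Poly_Mapping.single i k) 1 :: ipoly)"
      by (simp add: X_def mult_single single_add[symmetric])
    then show ?case using X mult Suc by metis
  qed
  have monom: "P (Poly_Mapping.single m 1)" for m
  proof (induction m rule: Poly_Mapping.update_induct)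
    case const
    then show ?case using P1 by simp
  next
    case (update m i k)
    then have "Poly_Mapping.single (Poly_Mapping.update i k m) 1
        = (Poly_Mapping.single m 1 * Poly_Mapping.single (Poly_Mapping.single i k) 1 :: ipoly)"
      by (simp add: update_eq_add_single mult_single)
    then show ?case using mult[OF update(3) monom_var] by simp
  qed
  show ?thesis
  proof (induction f rule: Poly_Mapping.update_induct)
    case const
    then show ?case using assms(1)[of 0] by simp
  next
    case (update f m c)
    have "Poly_Mapping.single m c = of_int c * (Poly_Mapping.single m 1 :: ipoly)"
      by (simp add: mult_single flip: single_of_int)
    then have "P (Poly_Mapping.single m c)"
      using mult[OF assms(1) monom] by simp
    then show ?case
      using update add update_eq_add_single by metis
  qed
qed

lemma inj_map_key: "inj (Poly_Mapping.map_key w :: (nat \<Rightarrow>\<^sub>0 nat) \<Rightarrow> _)" if "bij w"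
proof (rule injI)
  have w: "inj w" using that by (simp add: bij_is_inj)
  fix p q :: "nat \<Rightarrow>\<^sub>0 nat"
  assume "Poly_Mapping.map_key w p = Poly_Mapping.map_key w q"
  then have "Poly_Mapping.lookup p (w j) = Poly_Mapping.lookup q (w j)" for j
    by (metis (no_types) map_key.rep_eq[OF w] comp_apply)
  then show "p = q"
    by (intro poly_mapping_eqI) (metis that bij_pointE)
qed

lemma perm_poly_add: "bij w \<Longrightarrow> perm_poly w (f + g) = perm_poly w f + perm_poly w g"
  unfolding perm_poly_def by (rule map_key_plus[OF inj_map_key])

lemma perm_poly_comp:
  assumes "bij v" "bij w"
  shows "perm_poly v (perm_poly w f) = perm_poly (v \<circ> w) f"
proof -
  have "Poly_Mapping.map_key w \<circ> Poly_Mapping.map_key v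
      = (Poly_Mapping.map_key (v \<circ> w) :: (nat \<Rightarrow>\<^sub>0 nat) \<Rightarrow> _)"
    using map_key_compose[OF bij_is_inj[OF assms(2)] bij_is_inj[OF assms(1)]] by (auto simp: fun_eq_iff)
  then show ?thesis
    unfolding perm_poly_def
    using map_key_compose[OF inj_map_key[OF assms(1)] inj_map_key[OF assms(2)], of f] by simp
qed

lemma perm_poly_single:
  assumes "bij w"
  shows "perm_poly w (Poly_Mapping.single m c)
    = Poly_Mapping.single (Poly_Mapping.map_key (inv w) m) c"
proof -
  have "Poly_Mapping.map_key w (Poly_Mapping.map_key (inv w) m) = m"
    using assms map_key_compose[of w "inv w" m] map_key_id[of m]
    by (simp add: bij_is_inj bij_is_surj bij_imp_bij_inv surj_iff id_def)
  then show ?thesis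
    unfolding perm_poly_def using map_key_single[OF inj_map_key[OF assms]] by metis
qed

lemma perm_poly_of_int: "bij w \<Longrightarrow> perm_poly w (of_int c) = of_int c"
  using perm_poly_single[of w 0 c]
  by (simp add: map_key_zero[OF bij_is_inj[OF bij_imp_bij_inv]] single_of_int[symmetric] del: single_of_int)

text \<open>
  Reindexing the exponents is additive, so on single monomials the claim is the rule for adding
  exponents; two inductions over the monomials of \<open>g\<close> and of \<open>f\<close> give the rest.
\<close>

lemma perm_poly_mult:
  assumes "bij w"
  shows "perm_poly w (f * g) = perm_poly w f * perm_poly w g"
proof -
  have zero: "perm_poly w 0 = 0"
    unfolding perm_poly_def by (rule map_key_zero[OF inj_map_key[OF assms]])
  have add: "Poly_Mapping.map_key (inv w) (m + k)
      = Poly_Mapping.map_key (inv w) m + Poly_Mapping.map_key (inv w) k" for m k :: "nat \<Rightarrow>\<^sub>0 nat"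
    by (rule map_key_plus[OF bij_is_inj[OF bij_imp_bij_inv[OF assms]]])
  have single: "perm_poly w (Poly_Mapping.single m c * g)
      = perm_poly w (Poly_Mapping.single m c) * perm_poly w g" for m c
  proof (induction g rule: Poly_Mapping.update_induct)
    case const
    then show ?case by (simp add: zero)
  next
    case (update g k b)
    then show ?case
      by (simp add: update_eq_add_single distrib_left perm_poly_add[OF assms] mult_single
          perm_poly_single[OF assms] add)
  qed
  show ?thesis
  proof (induction f rule: Poly_Mapping.update_induct)
    case const
    then show ?case by (simp add: zero)
  next
    case (update f m c)
    then show ?case
      by (simp add: update_eq_add_single distrib_right perm_poly_add[OF assms] single)
  qed
qed

section \<open>Divided differences\<close>

abbreviation swap_vars :: "nat \<Rightarrow> ipoly \<Rightarrow> ipoly" where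
  "swap_vars i \<equiv> perm_poly (adj_transp i)"

lemma bij_adj_transp [simp]: "bij (adj_transp i)"
  by (simp add: adj_transp_def)

lemma adj_transp_twice [simp]: "adj_transp i \<circ> adj_transp i = id" "adj_transp i (adj_transp i j) = j"
  by (simp_all add: adj_transp_def)

lemma adj_transp_simps [simp]:
  "adj_transp i i = Suc i" "adj_transp i (Suc i) = i"
  "j \<noteq> i \<Longrightarrow> j \<noteq> Suc i \<Longrightarrow> adj_transp i j = j"
  by (simp_all add: adj_transp_def)

lemma adj_transp_comm:
  "Suc i < j \<Longrightarrow> adj_transp i \<circ> adj_transp j = adj_transp j \<circ> adj_transp i"
  by (auto simp: adj_transp_def transpose_def fun_eq_iff)

lemma adj_transp_braid:
  "adj_transp i \<circ> adj_transp (Suc i) \<circ> adj_transp i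
    = adj_transp (Suc i) \<circ> adj_transp i \<circ> adj_transp (Suc i)"
  by (auto simp: adj_transp_def transpose_def fun_eq_iff)

lemmas swap_vars_add = perm_poly_add[OF bij_adj_transp]
  and swap_vars_mult = perm_poly_mult[OF bij_adj_transp]
  and swap_vars_of_int = perm_poly_of_int[OF bij_adj_transp]

lemma swap_vars_X: "swap_vars i (X j) = X (adj_transp i j)"
  by (rule perm_poly_X) simp

lemma swap_vars_twice [simp]: "swap_vars i (swap_vars i f) = f"
proof (induction f rule: ipoly_induct)
qed (simp_all add: swap_vars_add swap_vars_mult swap_vars_of_int swap_vars_X)

lemma swap_vars_uminus: "swap_vars i (- f) = - swap_vars i f"
  using swap_vars_mult[of i "-1" f] swap_vars_of_int[of i "-1"] by simp

lemma swap_vars_diff: "swap_vars i (f - g) = swap_vars i f - swap_vars i g"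
  using swap_vars_add[of i f "-g"] by (simp add: swap_vars_uminus)

lemma swap_vars_prod: "swap_vars i (prod h S) = (\<Prod>x\<in>S. swap_vars i (h x))"
  using swap_vars_of_int[of i 1]
  by (induction S rule: infinite_finite_induct) (simp_all add: swap_vars_mult)

lemma swap_vars_one: "swap_vars i 1 = 1"
  using swap_vars_of_int[of i 1] by simp

lemma X_inject: "X i = X j \<longleftrightarrow> i = j"
  by (metis X_def inj_single injD zero_neq_one lookup_single_eq lookup_single_not_eq)

text \<open>
  The ordinary divided difference. The isobaric one is \<open>idd i f = dd i (X i * f)\<close>, and most
  computations are easier for \<open>dd\<close>.
\<close>

definition dd :: "nat \<Rightarrow> ipoly \<Rightarrow> ipoly" where
  "dd i f = (THE g. (X i - X (Suc i)) * g = f - swap_vars i f)"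

lemma X_diff_nonzero: "X i - X (Suc i) \<noteq> 0"
  using X_inject[of i "Suc i"] by simp

text \<open>
  Divisibility holds for constants and variables, and it passes to a product by
  \<open>f g - s(f) s(g) = (f - s(f)) g + s(f) (g - s(g))\<close>.
\<close>

lemma dd_exists: "\<exists>g. (X i - X (Suc i)) * g = f - swap_vars i f"
proof (induction f rule: ipoly_induct)
  case (const c)
  then show ?case by (intro exI[of _ 0]) (simp add: swap_vars_of_int)
next
  case (X j)
  show ?case
  proof (cases "j = i \<or> j = Suc i")
    case True
    then show ?thesis
      by (intro exI[of _ "if j = i then 1 else - 1"])
         (auto simp: swap_vars_X)
  next
    case False
    then show ?thesis by (intro exI[of _ 0]) (auto simp: swap_vars_X)
  qed
next
  case (add f g)
  then obtain p q where "(X i - X (Suc i)) * p = f - swap_vars i f"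
    "(X i - X (Suc i)) * q = g - swap_vars i g" by blast
  then show ?case
    by (intro exI[of _ "p + q"]) (simp add: swap_vars_add ring_distribs)
next
  case (mult f g)
  then obtain p q where "(X i - X (Suc i)) * p = f - swap_vars i f"
    "(X i - X (Suc i)) * q = g - swap_vars i g" by blast
  then have "(X i - X (Suc i)) * (p * g + swap_vars i f * q) = f * g - swap_vars i (f * g)"
    unfolding swap_vars_mult by algebra
  then show ?case by blast
qed

lemma dd_unique:
  assumes "(X i - X (Suc i)) * g = f - swap_vars i f"
  shows "dd i f = g"
  unfolding dd_def
proof (rule the_equality)
  fix h
  assume "(X i - X (Suc i)) * h = f - swap_vars i f"
  then show "h = g" using assms X_diff_nonzero by (metis mult_left_cancel)
qed (rule assms)

lemma dd_eq: "(X i - X (Suc i)) * dd i f = f - swap_vars i f"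
  using dd_exists dd_unique by metis

lemma dd_add: "dd i (f + g) = dd i f + dd i g"
  by (rule dd_unique) (simp add: dd_eq distrib_left swap_vars_add)

lemma dd_diff: "dd i (f - g) = dd i f - dd i g"
  by (rule dd_unique) (use dd_eq[of i f] dd_eq[of i g] in \<open>unfold swap_vars_diff, algebra\<close>)

lemma dd_leibniz: "dd i (f * g) = dd i f * g + swap_vars i f * dd i g"
  by (rule dd_unique) (use dd_eq[of i f] dd_eq[of i g] in \<open>unfold swap_vars_mult, algebra\<close>)

lemma dd_invariant: "swap_vars i f = f \<Longrightarrow> dd i f = 0"
  by (rule dd_unique) simp

lemma dd_zero: "dd i 0 = 0"
  by (rule dd_invariant) (use swap_vars_of_int[of i 0] in simp)

lemma dd_mult_invariant: "swap_vars i f = f \<Longrightarrow> dd i (f * g) = f * dd i g"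
  by (simp add: dd_leibniz dd_invariant)

lemma swap_vars_dd [simp]: "swap_vars i (dd i f) = dd i f"
proof -
  have "(X (Suc i) - X i) * swap_vars i (dd i f) = swap_vars i f - f"
    using arg_cong[OF dd_eq, of "swap_vars i" i f]
    by (simp add: swap_vars_mult swap_vars_diff swap_vars_X)
  then have "(X i - X (Suc i)) * swap_vars i (dd i f) = f - swap_vars i f" by algebra
  then show ?thesis using dd_unique by metis
qed

lemma dd_dd: "dd i (dd i f) = 0"
  by (simp add: dd_invariant)

lemma dd_X: "dd i (X i) = 1"
  by (rule dd_unique) (simp add: swap_vars_X)

lemma swap_vars_comm: "Suc i < j \<Longrightarrow> swap_vars i (swap_vars j f) = swap_vars j (swap_vars i f)"
  using adj_transp_comm[of i j] by (simp add: perm_poly_comp)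

lemma swap_vars_braid:
  "swap_vars i (swap_vars (Suc i) (swap_vars i f)) = swap_vars (Suc i) (swap_vars i (swap_vars (Suc i) f))"
  using adj_transp_braid[of i] by (simp add: perm_poly_comp bij_comp comp_assoc)

text \<open>
  Multiplied by both denominators, which the other transposition fixes, either side becomes
  the same alternating sum of four polynomials.
\<close>

lemma dd_comm:
  assumes "Suc i < j"
  shows "dd i (dd j f) = dd j (dd i f)"
proof (rule dd_unique)
  have fix_i: "swap_vars i (X j - X (Suc j)) = X j - X (Suc j)"
    and fix_j: "swap_vars j (X i - X (Suc i)) = X i - X (Suc i)"
    using assms by (simp_all add: swap_vars_diff swap_vars_X)
  have via_j: "(X i - X (Suc i)) * swap_vars j (dd i f) = swap_vars j (f - swap_vars i f)"
    unfolding dd_eq[of i f, symmetric] swap_vars_mult fix_j ..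
  have via_i: "(X j - X (Suc j)) * swap_vars i (dd j f) = swap_vars i (f - swap_vars j f)"
    unfolding dd_eq[of j f, symmetric] swap_vars_mult fix_i ..
  have "(X j - X (Suc j)) * ((X i - X (Suc i)) * dd j (dd i f))
      = (X i - X (Suc i)) * (dd i f - swap_vars j (dd i f))"
    using dd_eq[of j "dd i f"] by (simp add: mult.left_commute)
  also have "\<dots> = (f - swap_vars i f) - swap_vars j (f - swap_vars i f)"
    by (simp add: right_diff_distrib[of "X i - X (Suc i)"] via_j dd_eq)
  also have "\<dots> = (f - swap_vars j f) - swap_vars i (f - swap_vars j f)"
    using swap_vars_comm[OF assms] by (simp add: swap_vars_diff)
  also have "\<dots> = (X j - X (Suc j)) * (dd j f - swap_vars i (dd j f))"
    by (simp add: right_diff_distrib[of "X j - X (Suc j)"] via_i dd_eq)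
  finally show "(X i - X (Suc i)) * dd j (dd i f) = dd j f - swap_vars i (dd j f)"
    using X_diff_nonzero[of j] by (simp only: mult_cancel_left) blast
qed

text \<open>
  Multiplied by the Vandermonde product of the three variables, each side becomes the alternating
  sum of the images of \<open>f\<close> under the six permutations of these variables. The two sums differ
  only in how the longest permutation is written as a word.
\<close>

lemma dd_braid: "dd i (dd (Suc i) (dd i f)) = dd (Suc i) (dd i (dd (Suc i) f))"
proof -
  let ?s = "swap_vars i" and ?t = "swap_vars (Suc i)"
  define a b c where "a = X i" and "b = X (Suc i)" and "c = X (Suc (Suc i))"
  have sX: "?s a = b" "?s b = a" "?s c = c" and tX: "?t a = a" "?t b = c" "?t c = b"
    by (simp_all add: a_def b_def c_def swap_vars_X)
  have s: "(a - b) * dd i h = h - ?s h" and t: "(b - c) * dd (Suc i) h = h - ?t h" for h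
    using dd_eq[of i h] dd_eq[of "Suc i" h] by (simp_all add: a_def b_def c_def)
  note hom = swap_vars_mult swap_vars_diff sX tX
  have sts: "(a - b) * (b - c) * (a - c) * dd i (dd (Suc i) (dd i f))
      = f - ?s f - ?t f + ?t (?s f) + ?s (?t f) - ?s (?t (?s f))"
  proof -
    define g where "g = dd i f"
    define h where "h = dd (Suc i) g"
    have 1: "(a - b) * g = f - ?s f" unfolding g_def by (rule s)
    have 2: "(a - c) * ?t g = ?t f - ?t (?s f)" using arg_cong[OF 1, of ?t] by (simp add: hom)
    have 3: "(b - c) * ?s (?t g) = ?s (?t f) - ?s (?t (?s f))"
      using arg_cong[OF 2, of ?s] by (simp add: hom)
    have 4: "(b - c) * h = g - ?t g" unfolding h_def by (rule t)
    have 5: "(a - c) * ?s h = g - ?s (?t g)"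
      using arg_cong[OF 4, of ?s] by (simp add: hom g_def)
    have 6: "(a - b) * dd i h = h - ?s h" by (rule s)
    have "(a - b) * (b - c) * (a - c) * dd i h
        = f - ?s f - ?t f + ?t (?s f) + ?s (?t f) - ?s (?t (?s f))"
      using 1 2 3 4 5 6 by algebra
    then show ?thesis by (simp add: g_def h_def)
  qed
  have tst: "(a - b) * (b - c) * (a - c) * dd (Suc i) (dd i (dd (Suc i) f))
      = f - ?s f - ?t f + ?t (?s f) + ?s (?t f) - ?t (?s (?t f))"
  proof -
    define g where "g = dd (Suc i) f"
    define h where "h = dd i g"
    have 1: "(b - c) * g = f - ?t f" unfolding g_def by (rule t)
    have 2: "(a - c) * ?s g = ?s f - ?s (?t f)" using arg_cong[OF 1, of ?s] by (simp add: hom)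
    have 3: "(a - b) * ?t (?s g) = ?t (?s f) - ?t (?s (?t f))"
      using arg_cong[OF 2, of ?t] by (simp add: hom)
    have 4: "(a - b) * h = g - ?s g" unfolding h_def by (rule s)
    have 5: "(a - c) * ?t h = g - ?t (?s g)"
      using arg_cong[OF 4, of ?t] by (simp add: hom g_def)
    have 6: "(b - c) * dd (Suc i) h = h - ?t h" by (rule t)
    have "(a - b) * (b - c) * (a - c) * dd (Suc i) h
        = f - ?s f - ?t f + ?t (?s f) + ?s (?t f) - ?t (?s (?t f))"
      using 1 2 3 4 5 6 by algebra
    then show ?thesis by (simp add: g_def h_def)
  qed
  have "(a - b) * (b - c) * (a - c) \<noteq> 0"
    by (simp add: a_def b_def c_def X_inject)
  moreover have "(a - b) * (b - c) * (a - c) * dd i (dd (Suc i) (dd i f))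
      = (a - b) * (b - c) * (a - c) * dd (Suc i) (dd i (dd (Suc i) f))"
    using sts tst swap_vars_braid[of i f] by simp
  ultimately show ?thesis using mult_left_cancel by blast
qed

section \<open>Isobaric divided differences\<close>

lemma idd_eq_dd: "idd i f = dd i (X i * f)"
  unfolding idd_def dd_def
  by (simp add: swap_vars_mult swap_vars_X)

lemma idd_diff: "idd i (f - g) = idd i f - idd i g"
  by (simp add: idd_eq_dd right_diff_distrib dd_diff)

lemma idd_mult_invariant: "swap_vars i f = f \<Longrightarrow> idd i (f * g) = f * idd i g"
  using dd_mult_invariant[of i f "X i * g"] by (simp add: idd_eq_dd mult_ac)

lemma idd_invariant: "swap_vars i f = f \<Longrightarrow> idd i f = f"
  using dd_mult_invariant[of i f "X i"] by (simp add: idd_eq_dd dd_X mult.commute)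

lemma idd_comm:
  assumes "Suc i < j"
  shows "idd i (idd j f) = idd j (idd i f)"
proof -
  have i: "swap_vars i (X j) = X j" and j: "swap_vars j (X i) = X i"
    using assms by (simp_all add: swap_vars_X)
  have "idd i (idd j f) = dd i (dd j (X i * (X j * f)))"
    unfolding idd_eq_dd dd_mult_invariant[OF j] ..
  also have "\<dots> = dd j (dd i (X j * (X i * f)))"
    using dd_comm[OF assms] by (simp only: mult.left_commute)
  also have "\<dots> = idd j (idd i f)"
    unfolding idd_eq_dd dd_mult_invariant[OF i] ..
  finally show ?thesis .
qed

text \<open>
  With \<open>a = X i\<close> and \<open>b = X (Suc i)\<close>, both sides are the triple divided difference of
  \<open>a\<^sup>2 b f\<close>. The multiplications can be moved to the inside because \<open>dd (Suc i)\<close> commutes with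
  \<open>a\<close>, \<open>dd i\<close> commutes with \<open>a b\<close>, and \<open>b * dd i g = dd i (a * g) - g\<close>.
\<close>

lemma idd_braid: "idd i (idd (Suc i) (idd i f)) = idd (Suc i) (idd i (idd (Suc i) f))"
proof -
  define a b where "a = X i" and "b = X (Suc i)"
  have t_a: "swap_vars (Suc i) a = a" and s_ab: "swap_vars i (a * b) = a * b"
    and s_a: "swap_vars i a = b"
    by (simp_all add: a_def b_def swap_vars_mult swap_vars_X)
  have idds: "idd i h = dd i (a * h)" "idd (Suc i) h = dd (Suc i) (b * h)" for h
    by (simp_all add: idd_eq_dd a_def b_def)
  have "idd i (idd (Suc i) (idd i f)) = dd i (dd (Suc i) (a * b * dd i (a * f)))"
    by (simp add: idds dd_mult_invariant[OF t_a] mult.assoc)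
  also have "\<dots> = dd i (dd (Suc i) (dd i (a * b * (a * f))))"
    by (simp add: dd_mult_invariant[OF s_ab])
  also have "\<dots> = dd (Suc i) (dd i (dd (Suc i) (a * (a * b * f))))"
    by (simp add: dd_braid mult_ac)
  also have "\<dots> = dd (Suc i) (dd i (a * dd (Suc i) (a * b * f)))"
    by (simp add: dd_mult_invariant[OF t_a])
  also have "\<dots> = dd (Suc i) (dd (Suc i) (a * b * f) + b * dd i (dd (Suc i) (a * b * f)))"
    unfolding dd_leibniz[of i a] s_a using dd_X[of i] by (simp add: a_def)
  also have "\<dots> = dd (Suc i) (b * dd i (dd (Suc i) (a * b * f)))"
    by (simp only: dd_add dd_dd add_0)
  also have "\<dots> = idd (Suc i) (idd i (idd (Suc i) f))"
    by (simp add: idds mult.assoc dd_mult_invariant[OF t_a])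
  finally show ?thesis .
qed

section \<open>Products of sums of variables\<close>

lemma foldr_dd_mult_invariant:
  assumes "\<And>k. k \<in> set ks \<Longrightarrow> swap_vars k g = g"
  shows "foldr dd ks (g * f) = g * foldr dd ks f"
  using assms by (induction ks) (simp_all add: dd_mult_invariant)

lemma foldr_idd_mult_invariant:
  assumes "\<And>k. k \<in> set ks \<Longrightarrow> swap_vars k g = g"
  shows "foldr idd ks (g * f) = g * foldr idd ks f"
  using assms by (induction ks) (simp_all add: idd_mult_invariant)

lemma foldr_idd_diff: "foldr idd ks (f - g) = foldr idd ks f - foldr idd ks g"
  by (induction ks) (simp_all add: idd_diff)

lemma foldr_idd_invariant:
  assumes "\<And>k. k \<in> set ks \<Longrightarrow> swap_vars k f = f"
  shows "foldr idd ks f = f"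
  using assms by (induction ks) (simp_all add: idd_invariant)

lemma foldr_dd_comm:
  assumes "\<And>k. k \<in> set ks \<Longrightarrow> Suc i < k"
  shows "dd i (foldr dd ks f) = foldr dd ks (dd i f)"
  using assms by (induction ks) (simp_all add: dd_comm)

lemma swap_vars_prod_X:
  assumes "i \<in> S \<longleftrightarrow> Suc i \<in> S"
  shows "swap_vars i (\<Prod>j\<in>S. X j) = (\<Prod>j\<in>S. X j)"
proof -
  have "bij_betw (adj_transp i) S S"
    using assms by (intro bij_betw_byWitness[where f' = "adj_transp i"]) (auto simp: adj_transp_def transpose_def)
  then show ?thesis
    unfolding swap_vars_prod swap_vars_X by (rule prod.reindex_bij_betw)
qed

text \<open>
  The factor \<open>X k\<close> that belongs to \<open>idd k\<close> commutes with every later \<open>dd j\<close>, as \<open>j > k\<close>, so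
  all factors can be collected inside.
\<close>

lemma foldr_idd_eq_foldr_dd:
  assumes "a \<le> Suc n"
  shows "foldr idd [a..<Suc n] f = foldr dd [a..<Suc n] ((\<Prod>i\<in>{a..n}. X i) * f)"
  using assms
proof (induction a rule: inc_induct)
  case base
  then show ?case by simp
next
  case (step a)
  have "foldr idd [a..<Suc n] f = dd a (X a * foldr dd [Suc a..<Suc n] ((\<Prod>i\<in>{Suc a..n}. X i) * f))"
    using step by (simp add: upt_conv_Cons idd_eq_dd[of a] del: upt_Suc)
  also have "\<dots> = dd a (foldr dd [Suc a..<Suc n] (X a * ((\<Prod>i\<in>{Suc a..n}. X i) * f)))"
    by (subst foldr_dd_mult_invariant[of _ "X a"]) (auto simp: swap_vars_X)
  also have "X a * ((\<Prod>i\<in>{Suc a..n}. X i) * f) = (\<Prod>i\<in>{a..n}. X i) * f"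
    using step by (simp add: prod.atLeast_Suc_atMost mult.assoc)
  finally show ?case
    using step by (simp add: upt_conv_Cons del: upt_Suc)
qed

definition row :: "nat \<Rightarrow> nat \<Rightarrow> ipoly" where
  "row a n = (\<Prod>b\<in>{a<..n}. X a + X b)"

lemma row_Suc: "a \<le> n \<Longrightarrow> row a (Suc n) = row a n * (X a + X (Suc n))"
proof -
  assume "a \<le> n"
  then have "{a<..Suc n} = insert (Suc n) {a<..n}" by auto
  then show ?thesis by (simp add: row_def mult.commute)
qed

lemma swap_vars_row:
  assumes "a < k \<and> k \<noteq> n \<or> Suc k < a"
  shows "swap_vars k (row a n) = row a n"
proof -
  have "bij_betw (adj_transp k) {a<..n} {a<..n}"
    using assms by (intro bij_betw_byWitness[where f' = "adj_transp k"]) (auto simp: adj_transp_def transpose_def)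
  moreover have "adj_transp k a = a" using assms by auto
  ultimately show ?thesis
    unfolding row_def swap_vars_prod swap_vars_add swap_vars_X
    using prod.reindex_bij_betw[of "adj_transp k" _ _ "\<lambda>b. X a + X b"] by simp
qed

text \<open>
  Exchanging the variables \<open>k\<close> and \<open>Suc k\<close> exchanges the two rows, apart from the factor
  \<open>X k + X (Suc k)\<close>, which it fixes.
\<close>

lemma swap_vars_two_rows:
  assumes "Suc k \<le> n"
  shows "swap_vars k (row k n * row (Suc k) n) = row k n * row (Suc k) n"
proof -
  have eq: "row k n = (X k + X (Suc k)) * (\<Prod>b\<in>{Suc k<..n}. X k + X b)"
  proof -
    have "{k<..n} = insert (Suc k) {Suc k<..n}" using assms by auto
    then show ?thesis by (simp add: row_def)
  qed
  have "swap_vars k (\<Prod>b\<in>{Suc k<..n}. X k + X b) = row (Suc k) n"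
    "swap_vars k (row (Suc k) n) = (\<Prod>b\<in>{Suc k<..n}. X k + X b)"
    unfolding row_def swap_vars_prod swap_vars_add swap_vars_X
    by (auto intro!: prod.cong)
  then show ?thesis
    by (simp add: eq swap_vars_mult swap_vars_add swap_vars_X ac_simps)
qed

text \<open>
  Only the last factor of the row involves the variable \<open>Suc n\<close>, and its divided difference is 1.
\<close>

lemma dd_row_top:
  assumes "a \<le> n" "swap_vars (Suc n) f = f"
  shows "dd (Suc n) (row a (Suc n) * f) = row a n * f"
proof -
  have "swap_vars (Suc n) (row a n * f) = row a n * f"
    using assms by (simp add: swap_vars_mult swap_vars_row)
  moreover have "dd (Suc n) (X a + X (Suc n)) = 1"
    using assms by (simp add: dd_add dd_X dd_invariant swap_vars_X)
  moreover have "row a (Suc n) * f = row a n * f * (X a + X (Suc n))"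
    using assms by (simp add: row_Suc mult_ac)
  ultimately show ?thesis by (simp only: dd_mult_invariant mult_1_right)
qed

text \<open>
  When the row is lengthened together with the string of divided differences, each new operator
  only strips the new factor off.
\<close>

lemma dds_row_extend:
  assumes "foldr dd [a..<Suc m] (row a m * f) = 0" "a \<le> m" "m \<le> n"
    and "\<And>k. m < k \<Longrightarrow> swap_vars k f = f"
  shows "foldr dd [a..<Suc n] (row a n * f) = 0"
  using \<open>m \<le> n\<close>
proof (induction n rule: dec_induct)
  case base
  show ?case by fact
next
  case (step n)
  then show ?case using assms dd_row_top[of a n f] by simp
qed

text \<open>
  Rows of lengths \<open>l 1 \<ge> \<dots> \<ge> l d \<ge> d\<close>: row \<open>i\<close> stands for the pairs \<open>(i, b)\<close> with
  \<open>i < b \<le> l i\<close>. Such data amount to a symmetric partition with \<open>d\<close> diagonal cells.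
\<close>

context
  fixes l :: "nat \<Rightarrow> nat" and d :: nat
  assumes antimono_all: "\<forall>i j. 1 \<le> i \<and> i \<le> j \<and> j \<le> d \<longrightarrow> l j \<le> l i"
    and ge_all: "\<forall>i. 1 \<le> i \<and> i \<le> d \<longrightarrow> d \<le> l i"
begin

lemma row_antimono: "1 \<le> i \<Longrightarrow> i \<le> j \<Longrightarrow> j \<le> d \<Longrightarrow> l j \<le> l i"
  using antimono_all by blast

lemma row_ge: "1 \<le> i \<Longrightarrow> i \<le> d \<Longrightarrow> d \<le> l i"
  using ge_all by blast

text \<open>
  These are the rows from \<open>a\<close> on of the two products in question; a common factor 2 per row is
  left out of \<open>qrows\<close>.
\<close>

definition qrows :: "nat \<Rightarrow> ipoly" where
  "qrows a = (\<Prod>i\<in>{a..d}. X i * row i (l i))"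

definition prows :: "nat \<Rightarrow> ipoly" where
  "prows a = (\<Prod>i\<in>{a..d}. row i (Suc (l i)))"

lemma qrows_rec: "a \<le> d \<Longrightarrow> qrows a = X a * row a (l a) * qrows (Suc a)"
  by (simp add: qrows_def prod.atLeast_Suc_atMost)

lemma prows_rec: "a \<le> d \<Longrightarrow> prows a = row a (Suc (l a)) * prows (Suc a)"
  by (simp add: prows_def prod.atLeast_Suc_atMost)

lemma qrows_empty: "qrows (Suc d) = 1"
  by (simp add: qrows_def)

lemma prows_empty: "prows (Suc d) = 1"
  by (simp add: prows_def)

lemma swap_vars_qrows:
  assumes "1 \<le> a" "a \<le> d \<Longrightarrow> l a < k \<or> Suc k < a"
  shows "swap_vars k (qrows a) = qrows a"
  unfolding qrows_def swap_vars_prod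
proof (rule prod.cong)
  fix i assume "i \<in> {a..d}"
  then have "i < k \<and> l i < k \<or> Suc k < i"
    using assms row_antimono[of a i] row_ge[of i] by (auto intro: le_less_trans)
  then show "swap_vars k (X i * row i (l i)) = X i * row i (l i)"
    by (auto simp: swap_vars_mult swap_vars_X swap_vars_row)
qed simp

text \<open>
  By \<open>dds_row_extend\<close> only the shortest admissible \<open>n\<close> matters. For the last row this is
  \<open>n = d\<close> and the divided difference of a constant. Otherwise it is \<open>n = m\<close>, the length of
  the next row. Then the polynomial is \<open>X (Suc a) * g\<close> with \<open>g\<close> symmetric in the variables \<open>a\<close>
  and \<open>Suc a\<close>, and by the Leibniz rule only \<open>dd a (dd (Suc a) \<dots>)\<close> of \<open>g\<close> has to vanish. But
  \<open>g\<close> is itself of the form \<open>dd a \<dots>\<close>, so the braid relation turns \<open>dd a\<close>, \<open>dd (Suc a)\<close>,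
  \<open>dd a\<close> into an expression that begins, from the inside, with \<open>dd (Suc a)\<close>. Row \<open>a\<close> can then
  be taken out of the operators, and what is left vanishes by induction.
\<close>

lemma dds_row_qrows:
  assumes "1 \<le> a" "a \<le> d" "d \<le> n" "a < d \<Longrightarrow> l (Suc a) \<le> n"
  shows "foldr dd [a..<Suc n] (row a n * qrows (Suc a)) = 0"
  using assms(2,1,3,4)
proof (induction a arbitrary: n rule: inc_induct)
  case base
  show ?case
  proof (rule dds_row_extend[of d d])
    show "foldr dd [d..<Suc d] (row d d * qrows (Suc d)) = 0"
      by (simp add: qrows_empty row_def dd_invariant swap_vars_one)
  qed (use base in \<open>simp_all add: qrows_empty swap_vars_one\<close>)
next
  case (step a)
  define m where "m = l (Suc a)"
  have "d \<le> m" using step row_ge[of "Suc a"] by (simp add: m_def)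
  define L where "L = [Suc (Suc a)..<Suc m]"
  define K where "K = row (Suc a) m * qrows (Suc (Suc a))"
  define g where "g = row a m * K"
  define q where "q = foldr dd L (row a (Suc m) * K)"
  have upt: "[a..<Suc m] = a # Suc a # L" "[Suc a..<Suc m] = Suc a # L"
    using step \<open>d \<le> m\<close> by (simp_all add: L_def upt_conv_Cons del: upt_Suc)
  have IH: "foldr dd [Suc a..<Suc m] K = 0"
    unfolding K_def
    using step \<open>d \<le> m\<close> row_antimono[of "Suc a" "Suc (Suc a)"] by (intro step.IH) (auto simp: m_def)
  have inv_g: "swap_vars a g = g"
  proof -
    have "swap_vars a (qrows (Suc (Suc a))) = qrows (Suc (Suc a))"
      by (rule swap_vars_qrows) auto
    then show ?thesis
      using swap_vars_two_rows[of a m] step \<open>d \<le> m\<close>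
      by (simp add: g_def K_def swap_vars_mult[of _ _ "qrows (Suc (Suc a))"] flip: mult.assoc)
  qed
  \<comment> \<open>Since \<open>g\<close> is symmetric in the variables \<open>a\<close> and \<open>a + 1\<close>, it is the divided difference of
     the product in which row \<open>a\<close> has one more factor.\<close>
  have g_dd: "g = dd a (row a (Suc m) * K)"
  proof -
    have "row a (Suc m) * K = g * (X a + X (Suc m))"
      using step \<open>d \<le> m\<close> by (simp add: row_Suc g_def ac_simps)
    moreover have "dd a (X a + X (Suc m)) = 1"
      using step \<open>d \<le> m\<close> by (simp add: dd_add dd_X dd_invariant swap_vars_X)
    ultimately show ?thesis by (simp add: dd_mult_invariant[OF inv_g])
  qed
  have h: "foldr dd L g = dd a q"
    unfolding g_dd q_def by (rule foldr_dd_comm[symmetric]) (auto simp: L_def)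
  have "dd (Suc a) q = foldr dd [Suc a..<Suc m] (row a (Suc m) * K)"
    by (simp add: q_def upt del: upt_Suc)
  also have "\<dots> = row a (Suc m) * foldr dd [Suc a..<Suc m] K"
    by (rule foldr_dd_mult_invariant) (auto intro!: swap_vars_row)
  also have "\<dots> = 0" using IH by simp
  finally have q: "dd (Suc a) q = 0" .
  have "foldr dd [a..<Suc m] (row a m * qrows (Suc a)) = 0"
  proof -
    have "row a m * qrows (Suc a) = X (Suc a) * g"
      using step qrows_rec[of "Suc a"] by (simp add: g_def K_def m_def ac_simps)
    moreover have "foldr dd L (X (Suc a) * g) = X (Suc a) * dd a q"
      unfolding h[symmetric] by (rule foldr_dd_mult_invariant) (auto simp: L_def swap_vars_X)
    ultimately have "foldr dd [a..<Suc m] (row a m * qrows (Suc a))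
        = dd a (dd (Suc a) (X (Suc a) * dd a q))"
      by (simp add: upt del: upt_Suc)
    also have "\<dots> = dd a (dd a q + X (Suc (Suc a)) * dd (Suc a) (dd a q))"
      by (simp add: dd_leibniz dd_X swap_vars_X)
    also have "\<dots> = X (Suc (Suc a)) * dd a (dd (Suc a) (dd a q))"
      by (simp add: dd_add dd_dd dd_mult_invariant swap_vars_X)
    also have "\<dots> = X (Suc (Suc a)) * dd (Suc a) (dd a (dd (Suc a) q))"
      by (simp only: dd_braid)
    also have "\<dots> = 0" by (simp add: q dd_zero)
    finally show ?thesis .
  qed
  then show ?case
  proof (rule dds_row_extend)
    show "swap_vars k (qrows (Suc a)) = qrows (Suc a)" if "m < k" for k
      using that by (intro swap_vars_qrows) (auto simp: m_def)
  qed (use step \<open>d \<le> m\<close> in \<open>auto simp: m_def\<close>)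
qed

text \<open>
  Let \<open>F\<close> be the product of the rows after \<open>a\<close>, and \<open>m = l a\<close>. The longer row
  \<open>row a (Suc m)\<close> is invariant under the transpositions of \<open>Suc a, \<dots>, m\<close> and can be moved out
  of the operators, which by induction turns \<open>F\<close> into the product of longer rows. Replacing
  \<open>X a * row a m\<close> by \<open>row a (Suc m)\<close> costs \<open>X (Suc m) * row a m\<close>. On this error term
  the isobaric operators become ordinary ones applied to \<open>row a m * F\<close>, times a product of
  variables, and \<open>dds_row_qrows\<close> shows that it contributes 0.
\<close>

lemma idds_qrows:
  assumes "1 \<le> a" "a \<le> Suc d" "d \<le> n" "a \<le> d \<Longrightarrow> l a \<le> n"
  shows "foldr idd [a..<Suc n] (qrows a) = foldr idd [a..<Suc d] (prows a)"
  using assms(2,1,3,4)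
proof (induction a arbitrary: n rule: inc_induct)
  case base
  have "foldr idd ks 1 = 1" for ks
    by (rule foldr_idd_invariant) (rule swap_vars_one)
  then show ?case by (simp only: qrows_empty prows_empty)
next
  case (step a)
  define m where "m = l a"
  have m: "a \<le> d" "d \<le> m" "m \<le> n" "1 \<le> a" using step row_ge[of a] by (auto simp: m_def)
  define F where "F = qrows (Suc a)"
  have IH: "foldr idd [Suc a..<Suc m] F = foldr idd [Suc a..<Suc d] (prows (Suc a))"
    unfolding F_def using m row_antimono[of a "Suc a"] by (intro step.IH) (auto simp: m_def)
  have row_inv: "swap_vars k (row a (Suc m)) = row a (Suc m)" if "Suc a \<le> k" "k \<le> m" for k
    using that by (intro swap_vars_row) auto
  have vanish: "foldr idd [a..<Suc m] (X (Suc m) * (row a m * F)) = 0"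
  proof -
    have "foldr idd [a..<Suc m] (X (Suc m) * (row a m * F))
        = foldr dd [a..<Suc m] ((\<Prod>i\<in>{a..m}. X i) * (X (Suc m) * (row a m * F)))"
      using m by (intro foldr_idd_eq_foldr_dd) auto
    also have "(\<Prod>i\<in>{a..m}. X i) * (X (Suc m) * (row a m * F))
        = (\<Prod>i\<in>{a..Suc m}. X i) * (row a m * F)"
      using m by (simp add: prod.nat_ivl_Suc' mult_ac)
    also have "foldr dd [a..<Suc m] \<dots> = (\<Prod>i\<in>{a..Suc m}. X i) * foldr dd [a..<Suc m] (row a m * F)"
      by (rule foldr_dd_mult_invariant, rule swap_vars_prod_X) auto
    also have "\<dots> = 0"
      unfolding F_def using m dds_row_qrows[of a m] row_antimono[of a "Suc a"] by (simp add: m_def)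
    finally show ?thesis .
  qed
  have "foldr idd [a..<Suc n] (qrows a) = foldr idd [a..<Suc m] (foldr idd [Suc m..<Suc n] (qrows a))"
    using m upt_add_eq_append[of a "Suc m" "n - m"] by (simp del: upt_Suc)
  also have "foldr idd [Suc m..<Suc n] (qrows a) = qrows a"
    using m by (intro foldr_idd_invariant swap_vars_qrows) (auto simp: m_def)
  also have "foldr idd [a..<Suc m] (qrows a) = foldr idd [a..<Suc m] (row a (Suc m) * F)"
  proof -
    have "qrows a = row a (Suc m) * F - X (Suc m) * (row a m * F)"
      using m by (simp add: qrows_rec row_Suc F_def m_def algebra_simps)
    then show ?thesis by (simp only: foldr_idd_diff vanish diff_0_right)
  qed
  also have "\<dots> = idd a (row a (Suc m) * foldr idd [Suc a..<Suc m] F)"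
    using m row_inv foldr_idd_mult_invariant[of "[Suc a..<Suc m]" "row a (Suc m)" F]
    by (simp add: upt_conv_Cons del: upt_Suc)
  also have "\<dots> = idd a (row a (Suc m) * foldr idd [Suc a..<Suc d] (prows (Suc a)))"
    by (simp only: IH)
  also have "\<dots> = idd a (foldr idd [Suc a..<Suc d] (row a (Suc m) * prows (Suc a)))"
    by (subst foldr_idd_mult_invariant) (use m row_inv in auto)
  also have "\<dots> = foldr idd [a..<Suc d] (prows a)"
    using m by (simp add: upt_conv_Cons prows_rec m_def del: upt_Suc)
  finally show ?case .
qed

text \<open>
  Row \<open>k\<close> and all later rows have length \<open>d\<close> here, so in \<open>prows\<close> they reach up to the variable
  \<open>Suc d\<close>, and together they are the product over all pairs of variables from \<open>k\<close> to
  \<open>Suc d\<close>.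
\<close>

lemma swap_vars_prows:
  assumes "1 \<le> k" "k \<le> d" "l k = d"
  shows "swap_vars k (prows 1) = prows 1"
proof -
  have l_eq: "l i = d" if "k \<le> i" "i \<le> d" for i
    using that assms row_antimono[of k i] row_ge[of i] by simp
  have other: "swap_vars k (row i (Suc (l i))) = row i (Suc (l i))"
    if "i \<in> {1..d}" "i \<noteq> k" "i \<noteq> Suc k" for i
    using that assms row_ge[of i] by (intro swap_vars_row) auto
  show ?thesis
  proof (cases "k = d")
    case True
    have "row d (Suc d) = X d + X (Suc d)"
      using row_Suc[of d d] by (simp add: row_def)
    then have row_d: "swap_vars k (row k (Suc (l k))) = row k (Suc (l k))"
      using \<open>l k = d\<close> True by (simp add: swap_vars_add swap_vars_X add.commute)
    show ?thesis
      unfolding prows_def swap_vars_prod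
    proof (rule prod.cong)
      fix i assume "i \<in> {1..d}"
      then show "swap_vars k (row i (Suc (l i))) = row i (Suc (l i))"
        using other[of i] row_d True by (cases "i = k") simp_all
    qed simp
  next
    case False
    define S where "S = {1..d} - {k, Suc k}"
    have "{1..d} = insert k (insert (Suc k) S)" "k \<notin> S" "Suc k \<notin> S" "finite S"
      using assms False by (auto simp: S_def)
    then have "prows 1 = row k (Suc d) * row (Suc k) (Suc d) * (\<Prod>i\<in>S. row i (Suc (l i)))"
      using l_eq[of k] l_eq[of "Suc k"] assms False by (simp add: prows_def mult.assoc)
    moreover have "swap_vars k (\<Prod>i\<in>S. row i (Suc (l i))) = (\<Prod>i\<in>S. row i (Suc (l i)))"
      unfolding swap_vars_prod
    proof (rule prod.cong)
      fix i assume "i \<in> S"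
      then show "swap_vars k (row i (Suc (l i))) = row i (Suc (l i))"
        by (intro other) (simp_all add: S_def)
    qed simp
    moreover have "swap_vars k (row k (Suc d) * row (Suc k) (Suc d)) = row k (Suc d) * row (Suc k) (Suc d)"
      using assms by (intro swap_vars_two_rows) simp
    ultimately show ?thesis
      using swap_vars_mult[of k "row k (Suc d) * row (Suc k) (Suc d)"] by simp
  qed
qed

lemma diagram_eq_Sigma:
  assumes "\<And>i. 1 \<le> i \<Longrightarrow> \<mu> i = l i - (i - 1)" "\<And>i. d < i \<Longrightarrow> l i \<le> d"
  shows "diagram \<mu> = Sigma {1..d} (\<lambda>i. {1..\<mu> i})"
proof -
  have "i \<le> d" if "1 \<le> j" "j \<le> \<mu> i" "1 \<le> i" for i j
    using that assms(1)[of i] assms(2)[of i] by (cases "d < i") auto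
  then show ?thesis by (auto simp: diagram_def)
qed

lemma prod_diagram_eq_prows:
  assumes "\<And>i. 1 \<le> i \<Longrightarrow> \<mu> i = l i - (i - 1)" "\<And>i. d < i \<Longrightarrow> l i \<le> d"
  shows "(\<Prod>(i, j)\<in>diagram \<mu>. X i + X (i + j)) = prows 1"
proof -
  have "diagram \<mu> = Sigma {1..d} (\<lambda>i. {1..\<mu> i})"
    using assms by (rule diagram_eq_Sigma)
  then have "(\<Prod>(i, j)\<in>diagram \<mu>. X i + X (i + j)) = (\<Prod>i\<in>{1..d}. \<Prod>j\<in>{1..\<mu> i}. X i + X (i + j))"
    by (simp add: prod.Sigma)
  also have "\<dots> = (\<Prod>i\<in>{1..d}. row i (Suc (l i)))"
  proof (rule prod.cong)
    fix i assume i: "i \<in> {1..d}"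
    show "(\<Prod>j\<in>{1..\<mu> i}. X i + X (i + j)) = row i (Suc (l i))"
      unfolding row_def using i assms(1)[of i] row_ge[of i]
      by (intro prod.reindex_bij_witness[of _ "\<lambda>b. b - i" "\<lambda>j. i + j"]) auto
  qed simp
  finally show ?thesis by (simp add: prows_def)
qed

lemma prod_diagram_eq_qrows:
  assumes "\<And>i. 1 \<le> i \<Longrightarrow> \<mu> i = l i - (i - 1)" "\<And>i. d < i \<Longrightarrow> l i \<le> d"
  shows "(\<Prod>(i, j)\<in>diagram \<mu>. X i + X (i + j - 1)) = 2 ^ d * qrows 1"
proof -
  have "diagram \<mu> = Sigma {1..d} (\<lambda>i. {1..\<mu> i})"
    using assms by (rule diagram_eq_Sigma)
  then have "(\<Prod>(i, j)\<in>diagram \<mu>. X i + X (i + j - 1))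
      = (\<Prod>i\<in>{1..d}. \<Prod>j\<in>{1..\<mu> i}. X i + X (i + j - 1))"
    by (simp add: prod.Sigma)
  also have "\<dots> = (\<Prod>i\<in>{1..d}. 2 * (X i * row i (l i)))"
  proof (rule prod.cong)
    fix i assume i: "i \<in> {1..d}"
    have "(\<Prod>j\<in>{1..\<mu> i}. X i + X (i + j - 1)) = (\<Prod>b\<in>{i..l i}. X i + X b)"
      using i assms(1)[of i] row_ge[of i]
      by (intro prod.reindex_bij_witness[of _ "\<lambda>b. Suc b - i" "\<lambda>j. i + j - 1"]) auto
    also have "{i..l i} = insert i {i<..l i}" using i row_ge[of i] by auto
    also have "(\<Prod>b\<in>\<dots>. X i + X b) = 2 * (X i * row i (l i))"
      by (simp add: row_def flip: mult_2)
    finally show "(\<Prod>j\<in>{1..\<mu> i}. X i + X (i + j - 1)) = 2 * (X i * row i (l i))" .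
  qed simp
  finally show ?thesis by (simp add: qrows_def prod.distrib)
qed

end

section \<open>Inversions and reduced words\<close>

text \<open>
  The codomain is arbitrary because inversions are counted for permutations and also, in order to
  sort a weak composition decreasingly, for its negated parts.
\<close>

definition inversions :: "(nat \<Rightarrow> 'a::linorder) \<Rightarrow> (nat \<times> nat) set" where
  "inversions f = {(i, j). 1 \<le> i \<and> i < j \<and> f j < f i}"

lemma adj_transp_less:
  assumes "i < j" "(i, j) \<noteq> (k, Suc k)"
  shows "adj_transp k i < adj_transp k j"
  using assms by (auto simp: adj_transp_def transpose_def)

lemma one_le_adj_transp: "1 \<le> k \<Longrightarrow> 1 \<le> i \<Longrightarrow> 1 \<le> adj_transp k i"
  by (auto simp: adj_transp_def transpose_def)

text \<open>
  A transposition of neighbours keeps the order of every pair of positions but \<open>(k, Suc k)\<close>.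
\<close>

lemma bij_betw_inversions_adj_transp:
  assumes "1 \<le> k" "f (Suc k) < f k"
  shows "bij_betw (map_prod (adj_transp k) (adj_transp k))
           (inversions f - {(k, Suc k)}) (inversions (f \<circ> adj_transp k))"
proof (rule bij_betw_byWitness[where f' = "map_prod (adj_transp k) (adj_transp k)"])
  have "(adj_transp k i, adj_transp k j) \<in> inversions f - {(k, Suc k)}"
    if "(i, j) \<in> inversions (f \<circ> adj_transp k)" for i j
  proof -
    have ij: "1 \<le> i" "i < j" "f (adj_transp k j) < f (adj_transp k i)"
      using that by (auto simp: inversions_def)
    then have "(i, j) \<noteq> (k, Suc k)" using assms by auto
    then have "adj_transp k i < adj_transp k j" using ij adj_transp_less by blast
    moreover have "(adj_transp k i, adj_transp k j) \<noteq> (k, Suc k)"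
      using ij by (metis adj_transp_simps(1,2) adj_transp_twice(2) not_less_iff_gr_or_eq Pair_inject lessI)
    ultimately show ?thesis
      using ij assms one_le_adj_transp by (auto simp: inversions_def)
  qed
  then show "map_prod (adj_transp k) (adj_transp k) ` inversions (f \<circ> adj_transp k)
      \<subseteq> inversions f - {(k, Suc k)}"
    by auto
qed (use assms one_le_adj_transp adj_transp_less in \<open>auto simp: inversions_def\<close>)

lemma card_inversions_descent:
  assumes "finite (inversions f)" "1 \<le> k" "f (Suc k) < f k"
  shows "finite (inversions (f \<circ> adj_transp k))"
    and "Suc (card (inversions (f \<circ> adj_transp k))) = card (inversions f)"
proof -
  have mem: "(k, Suc k) \<in> inversions f" using assms by (auto simp: inversions_def)
  show "finite (inversions (f \<circ> adj_transp k))"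
    using bij_betw_inversions_adj_transp[of k f] assms bij_betw_finite by blast
  show "Suc (card (inversions (f \<circ> adj_transp k))) = card (inversions f)"
    using bij_betw_same_card[OF bij_betw_inversions_adj_transp[of k f]] assms mem
    by (metis card_Suc_Diff1)
qed

lemma card_inversions_ascent:
  assumes "finite (inversions f)" "1 \<le> k" "f k < f (Suc k)"
  shows "finite (inversions (f \<circ> adj_transp k))"
    and "card (inversions (f \<circ> adj_transp k)) = Suc (card (inversions f))"
proof -
  have twice: "f \<circ> adj_transp k \<circ> adj_transp k = f" by (simp add: comp_assoc)
  have "bij_betw (map_prod (adj_transp k) (adj_transp k))
     (inversions (f \<circ> adj_transp k) - {(k, Suc k)}) (inversions f)"
    using bij_betw_inversions_adj_transp[of k "f \<circ> adj_transp k"] assms unfolding twice by simp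
  then have "finite (inversions (f \<circ> adj_transp k) - {(k, Suc k)})"
    using assms bij_betw_finite by blast
  then show fin: "finite (inversions (f \<circ> adj_transp k))" by simp
  show "card (inversions (f \<circ> adj_transp k)) = Suc (card (inversions f))"
    using card_inversions_descent(2)[OF fin, of k] assms unfolding twice by simp
qed

lemma inversions_emptyI:
  assumes "\<And>k. 1 \<le> k \<Longrightarrow> f k \<le> f (Suc k)"
  shows "inversions f = {}"
proof -
  have "f i \<le> f j" if "1 \<le> i" "i \<le> j" for i j
    using that(2,1) by (induction j rule: dec_induct) (auto intro: order_trans[OF _ assms])
  then have "\<not> f j < f i" if "1 \<le> i" "i < j" for i j
    using that by (meson leD less_imp_le)
  then show ?thesis by (auto simp: inversions_def)
qed

lemma word_perm_simps [simp]: "word_perm [] = id" "word_perm (i # ks) = adj_transp i \<circ> word_perm ks"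
  by (simp_all add: word_perm_def)

lemma word_perm_append: "word_perm (ks @ js) = word_perm ks \<circ> word_perm js"
  by (induction ks) (simp_all add: comp_assoc)

lemma word_perm_rev: "word_perm ks \<circ> word_perm (rev ks) = id"
proof (induction ks)
  case (Cons i ks)
  have "word_perm (i # ks) \<circ> word_perm (rev (i # ks))
      = adj_transp i \<circ> (word_perm ks \<circ> word_perm (rev ks)) \<circ> adj_transp i"
    by (simp add: word_perm_append comp_assoc)
  also have "\<dots> = id" by (simp only: Cons comp_id adj_transp_twice)
  finally show ?case .
qed simp

lemma is_word_simps [simp]:
  "is_word []" "is_word (i # ks) \<longleftrightarrow> 1 \<le> i \<and> is_word ks"
  "is_word (ks @ js) \<longleftrightarrow> is_word ks \<and> is_word js" "is_word (rev ks) \<longleftrightarrow> is_word ks"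
  by (auto simp: is_word_def)

lemma bij_word_perm: "bij (word_perm ks)"
  by (induction ks) (simp_all only: word_perm_simps bij_id bij_comp bij_adj_transp)

lemma word_perm_0: "is_word ks \<Longrightarrow> word_perm ks 0 = 0"
  by (induction ks) auto

lemma S_inf_bij: "w \<in> S_inf \<Longrightarrow> bij w"
  by (auto simp: S_inf_def bij_word_perm)

lemma S_inf_0: "w \<in> S_inf \<Longrightarrow> w 0 = 0"
  by (auto simp: S_inf_def word_perm_0)

lemma S_inf_eq_iff: "w \<in> S_inf \<Longrightarrow> w i = w j \<longleftrightarrow> i = j"
  using S_inf_bij by (simp add: bij_is_inj inj_eq)

lemma S_inf_pos: "w \<in> S_inf \<Longrightarrow> 1 \<le> i \<Longrightarrow> 1 \<le> w i"
  using S_inf_eq_iff[of w i 0] S_inf_0[of w] by simp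

lemma S_inf_comp: "v \<in> S_inf \<Longrightarrow> w \<in> S_inf \<Longrightarrow> v \<circ> w \<in> S_inf"
  unfolding S_inf_def mem_Collect_eq by (metis is_word_simps(3) word_perm_append)

lemma word_perm_S_inf: "is_word ks \<Longrightarrow> word_perm ks \<in> S_inf"
  by (auto simp: S_inf_def)

lemma adj_transp_S_inf: "1 \<le> i \<Longrightarrow> adj_transp i \<in> S_inf"
  using word_perm_S_inf[of "[i]"] by simp

lemma inversions_word_perm:
  assumes "is_word ks"
  shows "finite (inversions (word_perm ks)) \<and> card (inversions (word_perm ks)) \<le> length ks"
  using assms
proof (induction ks rule: rev_induct)
  case Nil
  have "inversions (id :: nat \<Rightarrow> nat) = {}" by (auto simp: inversions_def)
  then show ?case by (simp only: word_perm_simps) simp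
next
  case (snoc k ks)
  let ?w = "word_perm ks"
  have eq: "word_perm (ks @ [k]) = ?w \<circ> adj_transp k" by (simp add: word_perm_append)
  have "?w k \<noteq> ?w (Suc k)" using bij_word_perm[of ks] by (metis bij_pointE n_not_Suc_n)
  then consider "?w (Suc k) < ?w k" | "?w k < ?w (Suc k)" by linarith
  then have "finite (inversions (?w \<circ> adj_transp k))
    \<and> card (inversions (?w \<circ> adj_transp k)) \<le> Suc (length ks)"
    using snoc card_inversions_descent[of ?w k] card_inversions_ascent[of ?w k]
    by cases auto
  then show ?case by (simp only: eq length_append_singleton)
qed

lemma finite_inversions_S_inf: "w \<in> S_inf \<Longrightarrow> finite (inversions w)"
  using inversions_word_perm by (auto simp: S_inf_def)

text \<open>
  Bubble sort: as long as there is an inversion there is one at neighbouring positions, and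
  exchanging these two removes exactly one inversion.
\<close>

lemma sort_by_word:
  fixes f :: "nat \<Rightarrow> 'a::linorder"
  assumes "finite (inversions f)"
  shows "\<exists>ks. is_word ks \<and> length ks = card (inversions f) \<and> inversions (f \<circ> word_perm ks) = {}"
  using assms
proof (induction "card (inversions f)" arbitrary: f rule: less_induct)
  case less
  show ?case
  proof (cases "inversions f = {}")
    case True
    then show ?thesis by (intro exI[of _ "[]"]) simp
  next
    case False
    then obtain k where k: "1 \<le> k" "f (Suc k) < f k"
      using inversions_emptyI[of f] by (meson not_le)
    note inv = card_inversions_descent[OF less.prems k]
    from less.hyps[OF _ inv(1)] inv(2) obtain ks where "is_word ks"
      "length ks = card (inversions (f \<circ> adj_transp k))"
      "inversions ((f \<circ> adj_transp k) \<circ> word_perm ks) = {}"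
      by auto
    then show ?thesis
      using k inv(2) by (intro exI[of _ "k # ks"]) (auto simp: comp_assoc)
  qed
qed

lemma eq_id_if_no_inversions:
  fixes w :: "nat \<Rightarrow> nat"
  assumes "bij w" "w 0 = 0" "inversions w = {}"
  shows "w = id"
proof -
  have inj: "w i = w j \<longleftrightarrow> i = j" for i j using assms(1) by (simp add: bij_is_inj inj_eq)
  have mono: "w i < w j" if "i < j" for i j
  proof -
    have "(i, j) \<notin> inversions w" using assms(3) by simp
    then show ?thesis
      using that assms(2) inj[of i j] inj[of 0 j] by (cases "i = 0") (auto simp: inversions_def)
  qed
  have ge: "i \<le> w i" for i using mono by (intro strict_mono_imp_increasing) (simp add: strict_mono_def)
  have "w i = i" for i
  proof (induction i rule: less_induct)
    case (less i)
    obtain m where m: "w m = i" using assms(1) by (metis bij_pointE)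
    then show ?case using less[of m] mono[of i m] ge[of i] by (cases m i rule: linorder_cases) auto
  qed
  then show ?thesis by auto
qed

lemma word_of_length_inversions:
  assumes "bij w" "w 0 = 0" "finite (inversions w)"
  shows "\<exists>ks. is_word ks \<and> word_perm ks = w \<and> length ks = card (inversions w)"
proof -
  obtain ks where ks: "is_word ks" "length ks = card (inversions w)"
    "inversions (w \<circ> word_perm ks) = {}"
    using sort_by_word[OF assms(3)] by blast
  have "w \<circ> word_perm ks = id"
    using ks assms by (intro eq_id_if_no_inversions) (auto simp: bij_comp bij_word_perm word_perm_0)
  then have "w \<circ> (word_perm ks \<circ> word_perm (rev ks)) = word_perm (rev ks)"
    by (simp flip: comp_assoc)
  then have "w = word_perm (rev ks)" by (simp add: word_perm_rev)
  then show ?thesis using ks by (intro exI[of _ "rev ks"]) auto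
qed

text \<open>
  Sorting \<open>w\<close> gives a word for its inverse, which is reversed to a word for \<open>w\<close> with as many
  letters as \<open>w\<close> has inversions. No word is shorter since one letter creates at most one
  inversion.
\<close>

lemma perm_length_eq_card_inversions:
  assumes "w \<in> S_inf"
  shows "perm_length w = card (inversions w)"
  unfolding perm_length_def
proof (rule Least_equality)
  show "\<exists>ks. is_word ks \<and> word_perm ks = w \<and> length ks = card (inversions w)"
    using assms by (intro word_of_length_inversions)
      (auto simp: S_inf_bij S_inf_0 finite_inversions_S_inf)
next
  fix n assume "\<exists>ks. is_word ks \<and> word_perm ks = w \<and> length ks = n"
  then show "card (inversions w) \<le> n" using inversions_word_perm by auto
qed

lemma perm_length_ascent:
  assumes "w \<in> S_inf" "1 \<le> k" "w k < w (Suc k)"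
  shows "perm_length (w \<circ> adj_transp k) = Suc (perm_length w)"
  using assms card_inversions_ascent(2)[of w k]
  by (simp add: perm_length_eq_card_inversions finite_inversions_S_inf S_inf_comp adj_transp_S_inf)

lemma perm_length_descent:
  assumes "w \<in> S_inf" "1 \<le> k" "w (Suc k) < w k"
  shows "Suc (perm_length (w \<circ> adj_transp k)) = perm_length w"
  using assms card_inversions_descent(2)[of w k]
  by (simp add: perm_length_eq_card_inversions finite_inversions_S_inf S_inf_comp adj_transp_S_inf)

lemma reduced_word_exists: "w \<in> S_inf \<Longrightarrow> \<exists>ks. reduced_word ks w"
  using word_of_length_inversions[of w]
  by (auto simp: reduced_word_def perm_length_eq_card_inversions S_inf_bij S_inf_0 finite_inversions_S_inf)

lemma reduced_word_S_inf: "reduced_word ks w \<Longrightarrow> w \<in> S_inf"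
  by (auto simp: reduced_word_def S_inf_def)

lemma reduced_word_snocD:
  assumes "reduced_word (ks @ [k]) w"
  shows "1 \<le> k" "w (Suc k) < w k" "reduced_word ks (w \<circ> adj_transp k)"
proof -
  have w: "w \<in> S_inf" and word: "is_word ks" "1 \<le> k" and len: "Suc (length ks) = perm_length w"
    using assms reduced_word_S_inf[OF assms] by (auto simp: reduced_word_def)
  have eq: "w \<circ> adj_transp k = word_perm ks"
    using assms by (auto simp: reduced_word_def word_perm_append comp_assoc)
  then have le: "perm_length (w \<circ> adj_transp k) \<le> length ks"
    using inversions_word_perm[OF word(1)] word_perm_S_inf[OF word(1)]
    by (simp add: perm_length_eq_card_inversions)
  show "1 \<le> k" by (fact word)
  show desc: "w (Suc k) < w k"
  proof (rule ccontr)
    assume "\<not> ?thesis"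
    then have "w k < w (Suc k)" using S_inf_eq_iff[OF w, of k "Suc k"] by simp
    then show False using perm_length_ascent[OF w word(2)] le len by simp
  qed
  show "reduced_word ks (w \<circ> adj_transp k)"
    using perm_length_descent[OF w word(2) desc] len eq word by (simp add: reduced_word_def)
qed

lemma reduced_word_snocI:
  assumes "reduced_word ks w" "1 \<le> k" "w k < w (Suc k)"
  shows "reduced_word (ks @ [k]) (w \<circ> adj_transp k)"
  using assms perm_length_ascent[OF reduced_word_S_inf[OF assms(1)] assms(2,3)]
  by (auto simp: reduced_word_def word_perm_append)

text \<open>
  The last letters \<open>i\<close> and \<open>j\<close> of two reduced words of \<open>w\<close> are descents of \<open>w\<close>. If they
  differ, \<open>w\<close> can be reduced further, to a permutation \<open>v\<close>, by the longest word in both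
  letters. A reduced word of \<open>v\<close> can be extended to \<open>w\<close> by either form of that longest word.
  By induction each given word may be replaced by the extension with the same last letter,
  and the two extensions act alike by commutation or by the braid relation.
\<close>

lemma foldr_idd_reduced_word_unique:
  assumes "reduced_word ks w" "reduced_word js w"
  shows "foldr idd ks f = foldr idd js f"
  using assms
proof (induction "length ks" arbitrary: ks js w f)
  case 0
  then have "length js = length ks" unfolding reduced_word_def by metis
  with 0 show ?case by simp
next
  case (Suc n)
  have main: "foldr idd (as @ [i]) f = foldr idd (bs @ [j]) f"
    if red: "reduced_word (as @ [i]) w" "reduced_word (bs @ [j]) w"
      and len: "n = length as" "n = length bs" and "i < j" for as bs i j
  proof -
    note i = reduced_word_snocD[OF red(1)] and j = reduced_word_snocD[OF red(2)]
    have w: "w \<in> S_inf" by (rule reduced_word_S_inf[OF red(1)])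
    show ?thesis
    proof (cases "Suc i < j")
      case True
      define v where "v = w \<circ> adj_transp i \<circ> adj_transp j"
      have v': "v = w \<circ> adj_transp j \<circ> adj_transp i"
        unfolding v_def comp_assoc adj_transp_comm[OF True] ..
      have "v \<in> S_inf" unfolding v_def using w i(1) j(1) by (intro S_inf_comp adj_transp_S_inf)
      then obtain vs where vs: "reduced_word vs v" using reduced_word_exists by blast
      have "reduced_word (vs @ [j]) (v \<circ> adj_transp j)"
        using True by (intro reduced_word_snocI[OF vs j(1)]) (use j(2) in \<open>simp add: v_def\<close>)
      then have "reduced_word (vs @ [j]) (w \<circ> adj_transp i)" by (simp add: v_def comp_assoc)
      then have as: "foldr idd as g = foldr idd (vs @ [j]) g" for g
        by (rule Suc.hyps(1)[OF len(1) i(3)])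
      have "reduced_word (vs @ [i]) (v \<circ> adj_transp i)"
        using True by (intro reduced_word_snocI[OF vs i(1)]) (use i(2) in \<open>simp add: v'\<close>)
      then have "reduced_word (vs @ [i]) (w \<circ> adj_transp j)" by (simp add: v' comp_assoc)
      then have bs: "foldr idd bs g = foldr idd (vs @ [i]) g" for g
        by (rule Suc.hyps(1)[OF len(2) j(3)])
      show ?thesis by (simp add: as bs idd_comm[OF True])
    next
      case False
      then have j_eq: "j = Suc i" using \<open>i < j\<close> by simp
      define v where "v = w \<circ> adj_transp i \<circ> adj_transp j \<circ> adj_transp i"
      have v': "v = w \<circ> adj_transp j \<circ> adj_transp i \<circ> adj_transp j"
        unfolding v_def j_eq using adj_transp_braid[of i] by (simp add: comp_assoc)
      have "v \<in> S_inf" unfolding v_def using w i(1) j(1) by (intro S_inf_comp adj_transp_S_inf)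
      then obtain vs where vs: "reduced_word vs v" using reduced_word_exists by blast
      have val: "v i = w (Suc j)" "v j = w j" "v (Suc j) = w i"
        by (simp_all add: v_def j_eq)
      have "reduced_word ((vs @ [i]) @ [j]) (v \<circ> adj_transp i \<circ> adj_transp j)"
        using val i(1,2) j(1,2) by (intro reduced_word_snocI[OF reduced_word_snocI[OF vs]]) (simp_all add: j_eq)
      then have "reduced_word (vs @ [i, j]) (w \<circ> adj_transp i)" by (simp add: v_def comp_assoc)
      then have as: "foldr idd as g = foldr idd (vs @ [i, j]) g" for g
        by (rule Suc.hyps(1)[OF len(1) i(3)])
      have "reduced_word ((vs @ [j]) @ [i]) (v \<circ> adj_transp j \<circ> adj_transp i)"
        using val i(1,2) j(1,2) by (intro reduced_word_snocI[OF reduced_word_snocI[OF vs]]) (simp_all add: j_eq)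
      then have "reduced_word (vs @ [j, i]) (w \<circ> adj_transp j)" by (simp add: v' comp_assoc)
      then have bs: "foldr idd bs g = foldr idd (vs @ [j, i]) g" for g
        by (rule Suc.hyps(1)[OF len(2) j(3)])
      show ?thesis by (simp add: as bs j_eq idd_braid)
    qed
  qed
  obtain as i bs j where eq: "ks = as @ [i]" "js = bs @ [j]" and len: "n = length as" "n = length bs"
  proof -
    have "length js = length ks" using Suc.prems by (simp add: reduced_word_def)
    then have "ks \<noteq> []" "js \<noteq> []" using Suc.hyps(2) by auto
    then show ?thesis using that Suc.hyps(2) \<open>length js = length ks\<close>
      by (metis append_butlast_last_id length_append_singleton nat.inject)
  qed
  consider "i < j" | "j < i" | "i = j" by linarith
  then show ?case
  proof cases
    case 3
    then have "reduced_word as (w \<circ> adj_transp i)" "reduced_word bs (w \<circ> adj_transp i)"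
      using reduced_word_snocD(3)[OF Suc.prems(1)[unfolded eq]]
        reduced_word_snocD(3)[OF Suc.prems(2)[unfolded eq]] by simp_all
    then show ?thesis using Suc.hyps(1)[OF len(1), of "w \<circ> adj_transp i" bs] 3 by (simp add: eq)
  next
    case 1
    show ?thesis
      unfolding eq by (rule main[OF Suc.prems[unfolded eq] len 1])
  next
    case 2
    show ?thesis
      unfolding eq by (rule main[OF Suc.prems(2,1)[unfolded eq] len(2,1) 2, symmetric])
  qed
qed

lemma idd_perm_reduced_word: "reduced_word ks w \<Longrightarrow> idd_perm w f = foldr idd ks f"
  unfolding idd_perm_def by (rule foldr_idd_reduced_word_unique[OF someI])

lemma idd_perm_ascent:
  assumes "w \<in> S_inf" "1 \<le> k" "w k < w (Suc k)"
  shows "idd_perm (w \<circ> adj_transp k) f = idd_perm w (idd k f)"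
proof -
  obtain ks where ks: "reduced_word ks w" using reduced_word_exists assms(1) by blast
  show ?thesis
    unfolding idd_perm_reduced_word[OF ks]
      idd_perm_reduced_word[OF reduced_word_snocI[OF ks assms(2,3)]] by simp
qed

section \<open>Cycles\<close>

text \<open>
  The product \<open>s\<^sub>1 \<dots> s\<^sub>k\<close>, the cycle that sends \<open>i\<close> to \<open>Suc i\<close> for \<open>1 \<le> i \<le> k\<close> and \<open>Suc k\<close>
  to 1.
\<close>

definition cycle :: "nat \<Rightarrow> nat \<Rightarrow> nat" where
  "cycle k = word_perm [1..<Suc k]"

lemma cycle_Suc: "cycle (Suc k) = cycle k \<circ> adj_transp (Suc k)"
  by (simp add: cycle_def word_perm_append)

lemma cycle_apply: "cycle k j = (if 1 \<le> j \<and> j \<le> k then Suc j else if j = Suc k then 1 else j)"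
proof (induction k arbitrary: j)
  case 0
  then show ?case by (simp add: cycle_def)
next
  case (Suc k)
  then show ?case by (auto simp: cycle_Suc adj_transp_def transpose_def)
qed

lemma cycle_S_inf: "cycle k \<in> S_inf"
  unfolding cycle_def by (rule word_perm_S_inf) (auto simp: is_word_def)

text \<open>
  As \<open>w\<close> fixes 1, it has no smaller value at a positive argument, so each letter of the cycle
  exchanges this value with a larger one and adds 1 to the length.
\<close>

lemma idd_perm_cycle:
  assumes "w \<in> S_inf" "w 1 = 1"
  shows "idd_perm (w \<circ> cycle k) f = idd_perm w (foldr idd [1..<Suc k] f)"
proof (induction k arbitrary: f)
  case 0
  then show ?case by (simp add: cycle_def)
next
  case (Suc k)
  have "w 1 < w (Suc (Suc k))"
    using assms S_inf_pos[OF assms(1), of "Suc (Suc k)"] S_inf_eq_iff[OF assms(1), of 1 "Suc (Suc k)"]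
    by simp
  then have "idd_perm (w \<circ> cycle k \<circ> adj_transp (Suc k)) f = idd_perm (w \<circ> cycle k) (idd (Suc k) f)"
    using assms by (intro idd_perm_ascent S_inf_comp cycle_S_inf) (simp_all add: cycle_apply)
  also have "\<dots> = idd_perm w (foldr idd [1..<Suc (Suc k)] f)" by (simp add: Suc)
  finally show ?case by (simp only: cycle_Suc comp_assoc)
qed

section \<open>Sorting weak compositions\<close>

text \<open>
  This applies to the sets \<open>{i. c \<le> \<mu> i}\<close> of a partition and determines them by their
  cardinality.
\<close>

lemma initial_segment_eq:
  assumes "finite A" "0 \<notin> A" "\<And>i j. 1 \<le> i \<Longrightarrow> i \<le> j \<Longrightarrow> j \<in> A \<Longrightarrow> i \<in> A"
  shows "A = {1..card A}"
proof (cases "A = {}")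
  case False
  have "A = {1..Max A}"
    using assms Max_in[OF assms(1) False] Max_ge[OF assms(1)]
    by (auto simp: Suc_le_eq) (metis gr0I)
  then show ?thesis by (metis card_atLeastAtMost diff_Suc_1)
qed simp

lemma partitionD:
  assumes "is_partition \<mu>"
  shows "\<mu> 0 = 0" "finite {i. \<mu> i \<noteq> 0}" "\<And>i j. 1 \<le> i \<Longrightarrow> i \<le> j \<Longrightarrow> \<mu> j \<le> \<mu> i"
  using assms by (auto simp: is_partition_def weak_composition_def)

lemma partition_level_set:
  assumes "is_partition \<mu>" "1 \<le> c"
  shows "{i. 1 \<le> i \<and> c \<le> \<mu> i} = {1..card {i. 1 \<le> i \<and> c \<le> \<mu> i}}"
proof (rule initial_segment_eq)
  show "finite {i. 1 \<le> i \<and> c \<le> \<mu> i}"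
    by (rule finite_subset[OF _ partitionD(2)[OF assms(1)]]) (use assms in auto)
qed (use partitionD(3)[OF assms(1)] in \<open>auto intro: order_trans\<close>)

text \<open>
  For each \<open>c \<ge> 1\<close> the sets of indices with part at least \<open>c\<close> are initial segments for both
  partitions, and \<open>p\<close> is a bijection between them; so they are equal.
\<close>

lemma partition_permuted_eq:
  assumes "is_partition \<mu>" "is_partition (\<mu> \<circ> p)" "bij p" "p 0 = 0"
  shows "\<mu> \<circ> p = \<mu>"
proof
  fix i
  have inj: "inj p" using assms(3) by (rule bij_is_inj)
  have level: "c \<le> \<mu> (p i) \<longleftrightarrow> c \<le> \<mu> i" if "1 \<le> c" "1 \<le> i" for c
  proof -
    define S T where "S = {i. 1 \<le> i \<and> c \<le> \<mu> (p i)}" and "T = {i. 1 \<le> i \<and> c \<le> \<mu> i}"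
    have "1 \<le> p m \<longleftrightarrow> 1 \<le> m" for m
      using inj_eq[OF inj, of m 0] assms(4) by (auto simp: Suc_le_eq)
    then have "S = p -` T" by (auto simp: S_def T_def)
    then have "card S = card T"
      using card_vimage_inj[OF inj, of T] assms(3) by (simp add: bij_is_surj)
    moreover have "S = {1..card S}" "T = {1..card T}"
      using partition_level_set[OF assms(1) that(1)] partition_level_set[OF assms(2) that(1)]
      by (simp_all only: S_def T_def comp_apply)
    ultimately have "S = T" by metis
    then show ?thesis using that by (auto simp: S_def T_def)
  qed
  show "(\<mu> \<circ> p) i = \<mu> i"
  proof (cases "i = 0")
    case False
    then have "\<mu> (p i) \<le> \<mu> i" using level[of "\<mu> (p i)"] by (cases "\<mu> (p i) = 0") auto
    moreover have "\<mu> i \<le> \<mu> (p i)" using level[of "\<mu> i"] False by (cases "\<mu> i = 0") auto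
    ultimately show ?thesis by simp
  qed (simp add: assms(4))
qed

lemma eq_act_iff: "w \<in> S_inf \<Longrightarrow> \<alpha> = act w \<mu> \<longleftrightarrow> \<alpha> \<circ> w = \<mu>"
  using S_inf_bij[of w] by (auto simp: act_def fun_eq_iff bij_is_inj) (metis bij_inv_eq_iff)

lemma sorters_agree:
  assumes "v \<in> S_inf" "w \<in> S_inf" "is_partition (\<alpha> \<circ> v)" "is_partition (\<alpha> \<circ> w)"
  shows "\<alpha> \<circ> v = \<alpha> \<circ> w"
proof -
  have v: "v (inv v k) = k" for k using S_inf_bij[OF assms(1)] by (simp add: bij_is_surj surj_f_inv_f)
  have eq: "(\<alpha> \<circ> v) \<circ> (inv v \<circ> w) = \<alpha> \<circ> w" by (simp add: v fun_eq_iff)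
  have "(\<alpha> \<circ> v) \<circ> (inv v \<circ> w) = \<alpha> \<circ> v"
  proof (rule partition_permuted_eq)
    show "bij (inv v \<circ> w)" using assms by (intro bij_comp bij_imp_bij_inv S_inf_bij)
    show "(inv v \<circ> w) 0 = 0"
      using v[of 0] S_inf_0[OF assms(1)] S_inf_0[OF assms(2)] S_inf_eq_iff[OF assms(1)]
      by (metis comp_apply)
  qed (use assms eq in simp_all)
  then show ?thesis using eq by simp
qed

lemma sorter_exists:
  assumes "weak_composition \<alpha>"
  shows "\<exists>w\<in>S_inf. is_partition (\<alpha> \<circ> w)"
proof -
  define f where "f = (\<lambda>i. - int (\<alpha> i))"
  have fin: "finite {i. \<alpha> i \<noteq> 0}" and zero: "\<alpha> 0 = 0"
    using assms by (auto simp: weak_composition_def)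
  have "inversions f \<subseteq> (\<lambda>(j, i). (i, j)) ` (SIGMA j:{i. \<alpha> i \<noteq> 0}. {..j})"
  proof clarify
    fix i j assume "(i, j) \<in> inversions f"
    then have "(j, i) \<in> (SIGMA j:{i. \<alpha> i \<noteq> 0}. {..j})" by (auto simp: inversions_def f_def)
    then show "(i, j) \<in> (\<lambda>(j, i). (i, j)) ` (SIGMA j:{i. \<alpha> i \<noteq> 0}. {..j})" by (rule rev_image_eqI) simp
  qed
  then have "finite (inversions f)" using fin by (auto intro: finite_subset)
  then obtain ks where ks: "is_word ks" "inversions (f \<circ> word_perm ks) = {}"
    using sort_by_word by blast
  let ?w = "word_perm ks"
  have w: "?w \<in> S_inf" by (rule word_perm_S_inf[OF ks(1)])
  have "\<alpha> (?w j) \<le> \<alpha> (?w i)" if "1 \<le> i" "i \<le> j" for i j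
  proof -
    have "(i, j) \<notin> inversions (f \<circ> ?w)" using ks(2) by simp
    then show ?thesis using that by (cases "i = j") (auto simp: inversions_def f_def)
  qed
  moreover have "finite {i. \<alpha> (?w i) \<noteq> 0}"
    using finite_vimageI[OF fin bij_is_inj[OF S_inf_bij[OF w]]] by (simp add: vimage_def)
  ultimately have "is_partition (\<alpha> \<circ> ?w)"
    using S_inf_0[OF w] zero by (simp add: is_partition_def weak_composition_def)
  then show ?thesis using w by blast
qed

lemma sort_part_eqI:
  assumes "w \<in> S_inf" "is_partition (\<alpha> \<circ> w)"
  shows "sort_part \<alpha> = \<alpha> \<circ> w"
  unfolding sort_part_def
proof (rule the_equality)
  fix \<mu> assume "is_partition \<mu> \<and> (\<exists>w\<in>S_inf. \<alpha> = act w \<mu>)"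
  then show "\<mu> = \<alpha> \<circ> w" using sorters_agree assms eq_act_iff by metis
qed (use assms eq_act_iff in blast)

text \<open>
  Neighbouring equal parts stay in order. For a permutation that sorts \<open>\<alpha>\<close> this is the same as
  minimal length, by \<open>sort_perm\<close> and \<open>sort_perm_eqI\<close>.
\<close>

definition stable_on :: "(nat \<Rightarrow> nat) \<Rightarrow> (nat \<Rightarrow> nat) \<Rightarrow> bool" where
  "stable_on \<alpha> w \<longleftrightarrow> (\<forall>i\<ge>1. \<alpha> (w i) = \<alpha> (w (Suc i)) \<longrightarrow> w i < w (Suc i))"

lemma stable_on_less:
  assumes "stable_on \<alpha> w" "is_partition (\<alpha> \<circ> w)" "1 \<le> i" "i < j" "\<alpha> (w i) = \<alpha> (w j)"
  shows "w i < w j"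
proof -
  have step: "w k < w (Suc k)" if "i \<le> k" "k < j" for k
  proof -
    have "\<alpha> (w k) \<le> \<alpha> (w i)" "\<alpha> (w (Suc k)) \<le> \<alpha> (w k)" "\<alpha> (w j) \<le> \<alpha> (w (Suc k))"
      using partitionD(3)[OF assms(2), of i k] partitionD(3)[OF assms(2), of k "Suc k"]
        partitionD(3)[OF assms(2), of "Suc k" j] that assms(3) by simp_all
    then show ?thesis using assms(1,3,5) that by (auto simp: stable_on_def)
  qed
  have "Suc i \<le> j" using assms by simp
  then show ?thesis
    using step
  proof (induction j rule: dec_induct)
    case base
    then show ?case by simp
  next
    case (step k)
    then have "w i < w k" "w k < w (Suc k)" by auto
    then show ?case by simp
  qed
qed

text \<open>
  If two neighbouring equal parts were exchanged by the shortest sorting permutation, undoing this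
  exchange would give a shorter one.
\<close>

lemma sort_perm:
  assumes "weak_composition \<alpha>"
  shows "sort_perm \<alpha> \<in> S_inf" "sort_part \<alpha> = \<alpha> \<circ> sort_perm \<alpha>" "is_partition (sort_part \<alpha>)"
    "stable_on \<alpha> (sort_perm \<alpha>)"
proof -
  obtain v where v: "v \<in> S_inf" "is_partition (\<alpha> \<circ> v)" using sorter_exists[OF assms] by blast
  have part: "sort_part \<alpha> = \<alpha> \<circ> v" using sort_part_eqI v by blast
  then show "is_partition (sort_part \<alpha>)" using v by simp
  let ?P = "\<lambda>u. u \<in> S_inf \<and> \<alpha> = act u (sort_part \<alpha>)"
  have "?P v" using v part eq_act_iff by auto
  then have P: "?P (sort_perm \<alpha>)" and min: "?P y \<Longrightarrow> perm_length (sort_perm \<alpha>) \<le> perm_length y" for y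
    unfolding sort_perm_def using arg_min_nat_lemma[of ?P v perm_length] by blast+
  show u: "sort_perm \<alpha> \<in> S_inf" using P by blast
  show sorted: "sort_part \<alpha> = \<alpha> \<circ> sort_perm \<alpha>" using P eq_act_iff[OF u] by metis
  show "stable_on \<alpha> (sort_perm \<alpha>)"
    unfolding stable_on_def
  proof (intro allI impI)
    fix i assume i: "1 \<le> i" and tie: "\<alpha> (sort_perm \<alpha> i) = \<alpha> (sort_perm \<alpha> (Suc i))"
    show "sort_perm \<alpha> i < sort_perm \<alpha> (Suc i)"
    proof (rule ccontr)
      assume "\<not> ?thesis"
      then have desc: "sort_perm \<alpha> (Suc i) < sort_perm \<alpha> i"
        using S_inf_eq_iff[OF u, of i "Suc i"] by simp
      have S: "sort_perm \<alpha> \<circ> adj_transp i \<in> S_inf" by (intro S_inf_comp u adj_transp_S_inf i)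
      have "\<alpha> \<circ> (sort_perm \<alpha> \<circ> adj_transp i) = sort_part \<alpha>"
        using tie sorted by (auto simp: fun_eq_iff adj_transp_def transpose_def)
      then have "perm_length (sort_perm \<alpha>) \<le> perm_length (sort_perm \<alpha> \<circ> adj_transp i)"
        using min S eq_act_iff[OF S] by metis
      then show False using perm_length_descent[OF u i desc] by simp
    qed
  qed
qed

text \<open>
  Two stable sorting permutations \<open>v\<close> and \<open>w\<close> differ by \<open>inv v \<circ> w\<close>, which permutes the
  positions of the sorted partition. An inversion of it would be at equal parts, and \<open>v\<close> and \<open>w\<close>
  would list the corresponding indices in opposite orders.
\<close>

lemma sort_perm_eqI:
  assumes "weak_composition \<alpha>" "w \<in> S_inf" "is_partition (\<alpha> \<circ> w)" "stable_on \<alpha> w"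
  shows "sort_perm \<alpha> = w"
proof -
  define v where "v = sort_perm \<alpha>"
  note v = sort_perm[OF assms(1), folded v_def]
  have eq: "\<alpha> \<circ> v = \<alpha> \<circ> w" using sort_part_eqI[OF assms(2,3)] v(2) by simp
  have inv: "v (inv v k) = k" for k using S_inf_bij[OF v(1)] by (simp add: bij_is_surj surj_f_inv_f)
  have p0: "inv v (w 0) = 0"
    using inv[of 0] S_inf_0[OF v(1)] S_inf_0[OF assms(2)] S_inf_eq_iff[OF v(1)] by metis
  have bij: "bij (inv v \<circ> w)" using v(1) assms(2) by (intro bij_comp bij_imp_bij_inv S_inf_bij)
  have "inv v \<circ> w = id"
  proof (rule eq_id_if_no_inversions)
    have False if ij: "1 \<le> i" "i < j" "inv v (w j) < inv v (w i)" for i j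
    proof -
      have "inv v (w j) \<noteq> 0"
        using p0 ij bij by (metis bij_is_inj comp_apply injD not_less_zero)
      then have le: "\<alpha> (w i) \<le> \<alpha> (w j)"
        using partitionD(3)[OF v(3), of "inv v (w j)" "inv v (w i)"] ij by (simp add: v(2) inv)
      moreover have "\<alpha> (w j) \<le> \<alpha> (w i)" using partitionD(3)[OF assms(3), of i j] ij by simp
      ultimately have tie: "\<alpha> (w i) = \<alpha> (w j)" by simp
      have "w i < w j" by (rule stable_on_less[OF assms(4,3) ij(1,2) tie])
      moreover have "v (inv v (w j)) < v (inv v (w i))"
        using \<open>inv v (w j) \<noteq> 0\<close> tie v(2,3) ij
        by (intro stable_on_less[OF v(4)]) (simp_all add: inv)
      ultimately show False by (simp add: inv)
    qed
    then show "inversions (inv v \<circ> w) = {}" by (auto simp: inversions_def)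
  qed (use p0 bij in auto)
  then have "v k = w k" for k using inv[of "w k"] by (metis comp_apply id_apply)
  then show ?thesis by (auto simp: v_def)
qed

lemma weak_composition_of_sorter:
  assumes "w \<in> S_inf" "is_partition (\<alpha> \<circ> w)"
  shows "weak_composition \<alpha>"
proof -
  have "{i. \<alpha> i \<noteq> 0} \<subseteq> w ` {i. (\<alpha> \<circ> w) i \<noteq> 0}"
    using S_inf_bij[OF assms(1)] by (auto simp: image_iff) (metis bij_pointE)
  then have "finite {i. \<alpha> i \<noteq> 0}"
    using partitionD(2)[OF assms(2)] by (meson finite_imageI finite_subset)
  then show ?thesis
    using partitionD(1)[OF assms(2)] S_inf_0[OF assms(1)] by (simp add: weak_composition_def)
qed

section \<open>Symmetric partitions and diagrams\<close>

lemma symmetric_partition_is_partition: "symmetric_partition \<mu> \<Longrightarrow> is_partition \<mu>"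
  unfolding symmetric_partition_def by blast

lemma symmetric_partition_swap:
  assumes "symmetric_partition \<mu>" "1 \<le> i" "1 \<le> j"
  shows "i \<le> \<mu> j \<longleftrightarrow> j \<le> \<mu> i"
proof -
  have part: "is_partition \<mu>" and eq: "\<mu> = transpose_part \<mu>"
    using assms(1) unfolding symmetric_partition_def by blast+
  have "card {i. 1 \<le> i \<and> j \<le> \<mu> i} = \<mu> j"
    using fun_cong[OF eq[symmetric], of j] assms(3) by (simp add: transpose_part_def)
  then have "{i. 1 \<le> i \<and> j \<le> \<mu> i} = {1..\<mu> j}" using partition_level_set[OF part assms(3)] by metis
  then have "i \<in> {i. 1 \<le> i \<and> j \<le> \<mu> i} \<longleftrightarrow> i \<in> {1..\<mu> j}" by (rule arg_cong)
  then show ?thesis using assms(2) by simp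
qed

lemma symmetric_partitionI:
  assumes "is_partition \<mu>" "\<And>i j. 1 \<le> i \<Longrightarrow> 1 \<le> j \<Longrightarrow> i \<le> \<mu> j \<longleftrightarrow> j \<le> \<mu> i"
  shows "symmetric_partition \<mu>"
proof -
  have "transpose_part \<mu> j = \<mu> j" for j
  proof (cases "j = 0")
    case False
    then have "1 \<le> j" by simp
    then have "{i. 1 \<le> i \<and> j \<le> \<mu> i} = {1..\<mu> j}"
      unfolding set_eq_iff mem_Collect_eq atLeastAtMost_iff using assms(2) by blast
    then show ?thesis using False unfolding transpose_part_def by simp
  next
    case True
    then show ?thesis using partitionD(1)[OF assms(1)] by (simp add: transpose_part_def)
  qed
  then have "\<mu> = transpose_part \<mu>" by (simp add: fun_eq_iff)
  then show ?thesis using assms(1) unfolding symmetric_partition_def by blast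
qed

text \<open>
  Other sorting permutations than \<open>sort_perm \<alpha>\<close> may be used: two of them differ by a permutation
  of rows of equal length, and applied to rows and columns simultaneously this preserves a
  symmetric diagram.
\<close>

lemma Dsym_eq:
  assumes "w \<in> S_inf" "symmetric_partition (\<alpha> \<circ> w)"
  shows "Dsym \<alpha> = {(w i, w j) | i j. (i, j) \<in> diagram (\<alpha> \<circ> w)}"
proof -
  have part: "is_partition (\<alpha> \<circ> w)" using symmetric_partition_is_partition assms by blast
  define v where "v = sort_perm \<alpha>"
  note v = sort_perm[OF weak_composition_of_sorter[OF assms(1) part], folded v_def]
  have eq: "sort_part \<alpha> = \<alpha> \<circ> w" by (rule sort_part_eqI[OF assms(1) part])
  have sub: "{(v i, v j) | i j. (i, j) \<in> diagram (\<alpha> \<circ> w)} \<subseteq> {(w i, w j) | i j. (i, j) \<in> diagram (\<alpha> \<circ> w)}"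
    if v: "v \<in> S_inf" and w: "w \<in> S_inf" and eq: "\<alpha> \<circ> v = \<alpha> \<circ> w" and sym: "symmetric_partition (\<alpha> \<circ> w)"
    for v w
  proof clarify
    fix i j assume ij: "(i, j) \<in> diagram (\<alpha> \<circ> w)"
    have sym: "a \<le> \<alpha> (w b) \<longleftrightarrow> b \<le> \<alpha> (w a)" if "1 \<le> a" "1 \<le> b" for a b
      using symmetric_partition_swap[OF sym that] by simp
    obtain a b where ab: "w a = v i" "w b = v j" using S_inf_bij[OF w] by (metis bij_pointE)
    have pos_ij: "1 \<le> i" "1 \<le> j" using ij by (auto simp: diagram_def)
    have "a \<noteq> 0" "b \<noteq> 0"
      using ab S_inf_0[OF w] S_inf_pos[OF v pos_ij(1)] S_inf_pos[OF v pos_ij(2)] by (cases a; cases b; simp)+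
    with pos_ij have pos: "1 \<le> a" "1 \<le> b" "1 \<le> i" "1 \<le> j" by simp_all
    have val: "\<alpha> (w a) = \<alpha> (w i)" "\<alpha> (w b) = \<alpha> (w j)" using ab eq by (metis comp_apply)+
    have "j \<le> \<alpha> (w i)" using ij by (simp add: diagram_def)
    then have "i \<le> \<alpha> (w b)" using sym[OF pos(3,4)] val by simp
    then have "b \<le> \<alpha> (w a)" using sym[OF pos(3,2)] val by simp
    then have "(a, b) \<in> diagram (\<alpha> \<circ> w)" using pos by (simp add: diagram_def)
    then show "\<exists>ia ja. (v i, v j) = (w ia, w ja) \<and> (ia, ja) \<in> diagram (\<alpha> \<circ> w)" using ab by metis
  qed
  have eq': "\<alpha> \<circ> v = \<alpha> \<circ> w" using v(2) eq by simp
  show ?thesis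
    unfolding Dsym_def v_def[symmetric] eq
  proof (rule equalityI)
    show "{(w i, w j) | i j. (i, j) \<in> diagram (\<alpha> \<circ> w)} \<subseteq> {(v i, v j) | i j. (i, j) \<in> diagram (\<alpha> \<circ> w)}"
      using sub[OF assms(1) v(1) eq'[symmetric]] assms(2) unfolding eq' by blast
  qed (rule sub[OF v(1) assms(1) eq' assms(2)])
qed

lemma row_of_Dsym:
  assumes "weak_composition \<alpha>" "1 \<le> k"
  shows "card {l. (k, l) \<in> Dsym \<alpha>} = \<alpha> k"
proof -
  note u = sort_perm[OF assms(1)]
  obtain i where i: "sort_perm \<alpha> i = k" using S_inf_bij[OF u(1)] by (metis bij_pointE)
  then have "i \<noteq> 0" using S_inf_0[OF u(1)] assms(2) by (cases i) auto
  then have "{l. (k, l) \<in> Dsym \<alpha>} = sort_perm \<alpha> ` {1..\<alpha> k}"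
    using i S_inf_eq_iff[OF u(1)] by (auto simp: Dsym_def diagram_def u(2))
  then show ?thesis
    using card_image[of "sort_perm \<alpha>" "{1..\<alpha> k}"] S_inf_bij[OF u(1)]
    by (simp add: bij_is_inj inj_on_subset[OF _ subset_UNIV])
qed

text \<open>
  This makes the compositions \<open>eta1\<close> and \<open>eta2\<close>, which are specified by their diagrams,
  unique.
\<close>

lemma Dsym_inject:
  assumes "weak_composition \<alpha>" "weak_composition \<beta>" "Dsym \<alpha> = Dsym \<beta>"
  shows "\<alpha> = \<beta>"
proof
  fix k show "\<alpha> k = \<beta> k"
    using row_of_Dsym[OF assms(1), of k] row_of_Dsym[OF assms(2), of k] assms
    by (cases "k = 0") (auto simp: weak_composition_def)
qed

lemma removable_corner_iff:
  assumes "is_partition \<mu>" "1 \<le> i"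
  shows "removable_corner \<mu> (i, j) \<longleftrightarrow> 1 \<le> j \<and> \<mu> i = j \<and> \<mu> (Suc i) < j"
proof
  assume "removable_corner \<mu> (i, j)"
  then obtain \<nu> where mem: "(i, j) \<in> diagram \<mu>" and \<nu>: "is_partition \<nu>" "diagram \<nu> = diagram \<mu> - {(i, j)}"
    by (auto simp: removable_corner_def)
  have iff: "b \<le> \<nu> a \<longleftrightarrow> b \<le> \<mu> a \<and> (a, b) \<noteq> (i, j)" if "1 \<le> a" "1 \<le> b" for a b
    using \<nu>(2) that by (auto simp: diagram_def set_eq_iff)
  have j: "1 \<le> j" "j \<le> \<mu> i" using mem by (auto simp: diagram_def)
  have "\<not> Suc j \<le> \<mu> i" using iff[of i "Suc j"] iff[of i j] assms j by auto
  moreover have "\<not> j \<le> \<mu> (Suc i)"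
    using iff[of "Suc i" j] iff[of i j] assms j partitionD(3)[OF \<nu>(1), of i "Suc i"] by auto
  ultimately show "1 \<le> j \<and> \<mu> i = j \<and> \<mu> (Suc i) < j" using j by auto
next
  assume j: "1 \<le> j \<and> \<mu> i = j \<and> \<mu> (Suc i) < j"
  let ?\<nu> = "\<mu>(i := j - 1)"
  have "finite {k. ?\<nu> k \<noteq> 0}"
    by (rule finite_subset[OF _ partitionD(2)[OF assms(1)]]) (use j in \<open>auto split: if_splits\<close>)
  moreover have "?\<nu> b \<le> ?\<nu> a" if "1 \<le> a" "a \<le> b" for a b
    using partitionD(3)[OF assms(1), of a b] partitionD(3)[OF assms(1), of "Suc i" b] that j by auto
  ultimately have "is_partition ?\<nu>"
    using partitionD(1)[OF assms(1)] assms(2) by (simp add: is_partition_def weak_composition_def)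
  moreover have "diagram ?\<nu> = diagram \<mu> - {(i, j)}"
    using j by (auto simp: diagram_def split: if_splits)
  moreover have "(i, j) \<in> diagram \<mu>" using j assms by (simp add: diagram_def)
  ultimately show "removable_corner \<mu> (i, j)" unfolding removable_corner_def by blast
qed

lemma addable_corner_iff:
  assumes "is_partition \<mu>" "1 \<le> i"
  shows "addable_corner \<mu> (i, j) \<longleftrightarrow> j = Suc (\<mu> i) \<and> (i = 1 \<or> j \<le> \<mu> (i - 1))"
proof
  assume "addable_corner \<mu> (i, j)"
  then obtain \<nu> where mem: "(i, j) \<notin> diagram \<mu>" and \<nu>: "is_partition \<nu>" "diagram \<nu> = insert (i, j) (diagram \<mu>)"
    by (auto simp: addable_corner_def)
  have iff: "b \<le> \<nu> a \<longleftrightarrow> b \<le> \<mu> a \<or> (a, b) = (i, j)" if "1 \<le> a" "1 \<le> b" for a b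
    using \<nu>(2) that by (auto simp: diagram_def set_eq_iff)
  have j: "1 \<le> j" using \<nu>(2) by (auto simp: diagram_def)
  then have less: "\<mu> i < j" using mem assms by (simp add: diagram_def)
  have "\<not> Suc (\<mu> i) < j"
  proof
    assume "Suc (\<mu> i) < j"
    then have "1 \<le> j - 1" "\<not> j - 1 \<le> \<mu> i" "j - 1 \<noteq> j" by auto
    moreover have "j - 1 \<le> \<nu> i" using iff[of i j] assms j by simp
    ultimately show False using iff[of i "j - 1"] assms by auto
  qed
  moreover have "j \<le> \<mu> (i - 1)" if "i \<noteq> 1"
  proof -
    have i: "1 \<le> i - 1" "i - 1 \<noteq> i" using that assms by auto
    have "j \<le> \<nu> i" using iff[of i j] assms j by simp
    also have "\<nu> i \<le> \<nu> (i - 1)" using i by (intro partitionD(3)[OF \<nu>(1)]) auto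
    finally show ?thesis using iff[of "i - 1" j] i j by auto
  qed
  ultimately show "j = Suc (\<mu> i) \<and> (i = 1 \<or> j \<le> \<mu> (i - 1))" using less by auto
next
  assume j: "j = Suc (\<mu> i) \<and> (i = 1 \<or> j \<le> \<mu> (i - 1))"
  let ?\<nu> = "\<mu>(i := j)"
  have "finite {k. ?\<nu> k \<noteq> 0}"
    by (rule finite_subset[of _ "insert i {k. \<mu> k \<noteq> 0}"]) (use partitionD(2)[OF assms(1)] in auto)
  moreover have "?\<nu> b \<le> ?\<nu> a" if "1 \<le> a" "a \<le> b" for a b
  proof (cases "b = i \<and> a \<noteq> i")
    case True
    then have "\<mu> (i - 1) \<le> \<mu> a" using that by (intro partitionD(3)[OF assms(1)]) auto
    then show ?thesis using True that j by auto
  qed (use partitionD(3)[OF assms(1), of a b] that j in auto)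
  ultimately have "is_partition ?\<nu>"
    using partitionD(1)[OF assms(1)] assms(2) by (simp add: is_partition_def weak_composition_def)
  moreover have "diagram ?\<nu> = insert (i, j) (diagram \<mu>)"
    using j assms by (auto simp: diagram_def split: if_splits)
  moreover have "(i, j) \<notin> diagram \<mu>" using j by (simp add: diagram_def)
  ultimately show "addable_corner \<mu> (i, j)" unfolding addable_corner_def by blast
qed

section \<open>Halves of symmetric partitions\<close>

text \<open>
  A nonzero part stands at the index that counts the parts which are at least as large.
\<close>

lemma strict_partition_unique:
  assumes "strict_partition \<mu>" "strict_partition \<nu>" "range \<mu> - {0} = range \<nu> - {0}"
  shows "\<mu> = \<nu>"
proof -
  have index: "card {p \<in> range \<mu> - {0}. \<mu> i \<le> p} = i" if "strict_partition \<mu>" "\<mu> i \<noteq> 0" for \<mu> :: "nat \<Rightarrow> nat" and i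
  proof -
    have part: "is_partition \<mu>" and inj: "inj_on \<mu> {i. \<mu> i \<noteq> 0}"
      using that by (auto simp: strict_partition_def)
    note \<mu> = partitionD[OF part]
    have "i \<noteq> 0" using that(2) \<mu>(1) by (cases i) auto
    have le: "j \<le> i" if "\<mu> i \<le> \<mu> j" "\<mu> j \<noteq> 0" for j
    proof (rule ccontr)
      assume "\<not> j \<le> i"
      then have "\<mu> j = \<mu> i" using \<mu>(3)[of i j] \<open>i \<noteq> 0\<close> that by simp
      then show False using inj_onD[OF inj, of j i] that \<open>\<not> j \<le> i\<close> by simp
    qed
    have "{p \<in> range \<mu> - {0}. \<mu> i \<le> p} = \<mu> ` {1..i}"
    proof (intro equalityI subsetI)
      fix p assume "p \<in> {p \<in> range \<mu> - {0}. \<mu> i \<le> p}"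
      then obtain j where j: "p = \<mu> j" "\<mu> j \<noteq> 0" "\<mu> i \<le> \<mu> j" by auto
      then have "j \<noteq> 0" using \<mu>(1) by (cases j) auto
      then show "p \<in> \<mu> ` {1..i}" using j le[of j] by auto
    next
      fix p assume "p \<in> \<mu> ` {1..i}"
      then obtain j where "p = \<mu> j" "1 \<le> j" "j \<le> i" by auto
      then show "p \<in> {p \<in> range \<mu> - {0}. \<mu> i \<le> p}" using \<mu>(3)[of j i] \<open>\<mu> i \<noteq> 0\<close> by auto
    qed
    moreover have "{1..i} \<subseteq> {j. \<mu> j \<noteq> 0}"
    proof
      fix j assume "j \<in> {1..i}"
      then show "j \<in> {j. \<mu> j \<noteq> 0}" using \<mu>(3)[of j i] \<open>\<mu> i \<noteq> 0\<close> by auto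
    qed
    then have "inj_on \<mu> {1..i}" by (rule inj_on_subset[OF inj])
    ultimately show ?thesis by (simp add: card_image)
  qed
  have eq: "\<nu> i = \<mu> i"
    if strict: "strict_partition \<mu>" "strict_partition \<nu>"
      and range: "range \<mu> - {0} = range \<nu> - {0}" and nonzero: "\<mu> i \<noteq> 0"
    for \<mu> \<nu> :: "nat \<Rightarrow> nat" and i
  proof -
    have "\<mu> i \<in> range \<mu> - {0}" using nonzero by simp
    then obtain j where j: "\<nu> j = \<mu> i" unfolding range by auto
    have "i = card {p \<in> range \<mu> - {0}. \<mu> i \<le> p}" using index[OF strict(1) nonzero] by (rule sym)
    also have "\<dots> = card {p \<in> range \<nu> - {0}. \<nu> j \<le> p}" unfolding range j ..
    also have "\<dots> = j" using nonzero j by (intro index strict(2)) simp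
    finally have "i = j" .
    then show ?thesis using j by simp
  qed
  show ?thesis
  proof
    fix i show "\<mu> i = \<nu> i"
      using eq[OF assms, of i] eq[OF assms(2,1) assms(3)[symmetric], of i] by (cases "\<mu> i = 0") auto
  qed
qed

lemma strict_partitionI:
  assumes "\<mu> 0 = 0" "finite {i. \<mu> i \<noteq> 0}"
    and "\<And>i j. 1 \<le> i \<Longrightarrow> i < j \<Longrightarrow> \<mu> j \<noteq> 0 \<Longrightarrow> \<mu> j < \<mu> i"
  shows "strict_partition \<mu>"
proof -
  have "\<mu> j \<le> \<mu> i" if "1 \<le> i" "i \<le> j" for i j
    using assms(3)[of i j] that by (cases "i = j"; cases "\<mu> j = 0") auto
  moreover have "inj_on \<mu> {i. \<mu> i \<noteq> 0}"
  proof (rule linorder_inj_onI)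
    fix i j assume "i < j" "i \<in> {i. \<mu> i \<noteq> 0}" "j \<in> {i. \<mu> i \<noteq> 0}"
    then show "\<mu> i \<noteq> \<mu> j" using assms(1) assms(3)[of i j] by (cases "i = 0") auto
  qed auto
  ultimately show ?thesis
    using assms(1,2) by (simp add: strict_partition_def is_partition_def weak_composition_def)
qed

lemma half_lt_eq:
  assumes "is_partition l"
  shows "half_lt l = (\<lambda>i. l i - i)"
  unfolding half_lt_def
proof (rule the_equality)
  note l = partitionD[OF assms]
  have "finite {i. l i - i \<noteq> 0}" by (rule finite_subset[OF _ l(2)]) auto
  moreover have "l j - j < l i - i" if "1 \<le> i" "i < j" "l j - j \<noteq> 0" for i j
    using l(3)[of i j] that by auto
  ultimately have strict: "strict_partition (\<lambda>i. l i - i)" using l(1) by (intro strict_partitionI) auto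
  have range: "range (\<lambda>i. l i - i) - {0} = {l i - i |i. 1 \<le> i} - {0}"
    using l(1) by auto (metis Suc_leI diff_is_0_eq' gr0I le_refl less_numeral_extra(3))
  show "strict_partition (\<lambda>i. l i - i) \<and> range (\<lambda>i. l i - i) - {0} = {l i - i |i. 1 \<le> i} - {0}"
    using strict range by blast
  show "\<mu> = (\<lambda>i. l i - i)"
    if "strict_partition \<mu> \<and> range \<mu> - {0} = {l i - i |i. 1 \<le> i} - {0}" for \<mu>
    using strict_partition_unique[OF _ strict] range that by simp
qed

lemma half_le_eq:
  assumes "is_partition l"
  shows "half_le l = (\<lambda>i. if i = 0 then 0 else l i - (i - 1))"
  unfolding half_le_def
proof (rule the_equality)
  let ?\<mu> = "\<lambda>i. if i = 0 then 0 else l i - (i - 1)"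
  note l = partitionD[OF assms]
  have "finite {i. ?\<mu> i \<noteq> 0}" by (rule finite_subset[OF _ l(2)]) auto
  moreover have "?\<mu> j < ?\<mu> i" if "1 \<le> i" "i < j" "?\<mu> j \<noteq> 0" for i j
    using l(3)[of i j] that by auto
  ultimately have strict: "strict_partition ?\<mu>" by (intro strict_partitionI) auto
  have range: "range ?\<mu> - {0} = {l i - (i - 1) |i. 1 \<le> i} - {0}"
  proof -
    have nats: "(UNIV :: nat set) = insert 0 {1..}" by auto
    have "range ?\<mu> = insert (?\<mu> 0) (?\<mu> ` {1..})" by (subst nats) (rule image_insert)
    also have "?\<mu> ` {1..} = (\<lambda>i. l i - (i - 1)) ` {1..}" by (intro image_cong) auto
    also have "\<dots> = {l i - (i - 1) |i. 1 \<le> i}" unfolding atLeast_def by blast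
    finally show ?thesis by auto
  qed
  show "strict_partition ?\<mu> \<and> range ?\<mu> - {0} = {l i - (i - 1) |i. 1 \<le> i} - {0}"
    using strict range by blast
  show "\<mu> = ?\<mu>"
    if "strict_partition \<mu> \<and> range \<mu> - {0} = {l i - (i - 1) |i. 1 \<le> i} - {0}" for \<mu>
    using strict_partition_unique[OF _ strict] range that by simp
qed

section \<open>Inserting a row and a column behind the diagonal\<close>

text \<open>
  The partition \<open>l\<close> with diagonal length \<open>d\<close>, after a row and a column of length \<open>e\<close> have been
  inserted behind the first \<open>d\<close>; both \<open>e = d\<close> and \<open>e = Suc d\<close> will occur.
\<close>

definition bordered :: "(nat \<Rightarrow> nat) \<Rightarrow> nat \<Rightarrow> nat \<Rightarrow> nat \<Rightarrow> nat" where
  "bordered l d e i =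
     (if i = 0 then 0 else if i \<le> d then Suc (l i) else if i = Suc d then e else l (i - 1))"

text \<open>
  The same parts with the new one moved to the front, as it is found in \<open>eta1\<close> and \<open>eta2\<close> at
  the index 1.
\<close>

definition shifted :: "(nat \<Rightarrow> nat) \<Rightarrow> nat \<Rightarrow> nat \<Rightarrow> nat \<Rightarrow> nat" where
  "shifted l d e j =
     (if j = 0 then 0 else if j = 1 then e else if j \<le> Suc d then Suc (l (j - 1)) else l (j - 1))"

lemma shifted_cycle: "shifted l d e \<circ> cycle d = bordered l d e"
  by (auto simp: fun_eq_iff shifted_def bordered_def cycle_apply)

text \<open>
  For \<open>e = Suc d\<close> the new part equals those that came from rows of length \<open>d\<close>, so it may as well
  be placed in front of them; this is the stable choice.
\<close>

lemma shifted_cycle_ties: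
  assumes "t \<le> d" "\<And>i. t < i \<Longrightarrow> i \<le> d \<Longrightarrow> l i = d"
  shows "shifted l d (Suc d) \<circ> cycle t = bordered l d (Suc d)"
proof
  fix i show "(shifted l d (Suc d) \<circ> cycle t) i = bordered l d (Suc d) i"
    using assms(1) assms(2)[of i] assms(2)[of "i - 1"]
    by (cases "i \<le> t"; cases "i = Suc t"; cases "i \<le> d"; cases "i = Suc d")
       (auto simp: shifted_def bordered_def cycle_apply)
qed

lemma durfee_exists:
  assumes "is_partition l"
  shows "\<exists>d. \<forall>i\<ge>1. i \<le> l i \<longleftrightarrow> i \<le> d"
proof -
  define A where "A = {i. 1 \<le> i \<and> i \<le> l i}"
  have "A = {1..card A}"
  proof (rule initial_segment_eq)
    show "finite A" by (rule finite_subset[OF _ partitionD(2)[OF assms]]) (auto simp: A_def)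
    show "i \<in> A" if "1 \<le> i" "i \<le> j" "j \<in> A" for i j
      using that partitionD(3)[OF assms, of i j] by (auto simp: A_def)
  qed (simp add: A_def)
  then have mem: "i \<in> A \<longleftrightarrow> i \<in> {1..card A}" for i by (rule arg_cong)
  have "i \<le> l i \<longleftrightarrow> i \<le> card A" if "1 \<le> i" for i
    using mem[of i] that unfolding A_def mem_Collect_eq atLeastAtMost_iff by blast
  then show ?thesis by blast
qed

text \<open>
  The last assumption says that \<open>d\<close> is the number of diagonal cells, the Durfee size, of \<open>l\<close>.
\<close>

context
  fixes l :: "nat \<Rightarrow> nat" and d :: nat
  assumes sym: "symmetric_partition l"
    and durfee_all: "\<forall>i\<ge>1. i \<le> l i \<longleftrightarrow> i \<le> d"
begin

lemma durfee: "1 \<le> i \<Longrightarrow> i \<le> l i \<longleftrightarrow> i \<le> d"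
  using durfee_all by blast

lemma l_partition: "is_partition l"
  by (rule symmetric_partition_is_partition[OF sym])

lemma l_swap: "1 \<le> i \<Longrightarrow> 1 \<le> j \<Longrightarrow> i \<le> l j \<longleftrightarrow> j \<le> l i"
  by (rule symmetric_partition_swap[OF sym])

lemma l_antimono: "1 \<le> i \<Longrightarrow> i \<le> j \<Longrightarrow> l j \<le> l i"
  by (rule partitionD(3)[OF l_partition])

lemma l_ge_durfee: "1 \<le> i \<Longrightarrow> i \<le> d \<Longrightarrow> d \<le> l i"
  using durfee[of d] l_antimono[of i d] by auto

lemma l_le_durfee:
  assumes "d < i"
  shows "l i \<le> d"
proof (rule ccontr)
  assume "\<not> l i \<le> d"
  then have "i \<le> l (Suc d)" using l_swap[of "Suc d" i] assms by simp
  then show False using durfee[of "Suc d"] assms by simp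
qed

text \<open>
  By symmetry \<open>l (Suc d)\<close> is the number of rows longer than \<open>d\<close>.
\<close>

lemma tie_rows: "l (Suc d) < i \<Longrightarrow> i \<le> d \<Longrightarrow> l i = d"
  using l_swap[of i "Suc d"] l_ge_durfee[of i] by (cases "l i = d") auto

lemma l_le_durfee_pred: "Suc d < i \<Longrightarrow> l (i - 1) \<le> d"
  by (rule l_le_durfee) simp

lemma l_antimono_pred: "Suc d < i \<Longrightarrow> i \<le> j \<Longrightarrow> l (j - 1) \<le> l (i - 1)"
  by (rule l_antimono) auto

lemma l_swap_pred: "Suc d < j \<Longrightarrow> 1 \<le> i \<Longrightarrow> i \<le> l (j - 1) \<longleftrightarrow> j \<le> Suc (l i)"
  using l_swap[of i "j - 1"] by auto

lemma bordered_antimono: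
  assumes "e = d \<or> e = Suc d" "1 \<le> i" "i \<le> j"
  shows "bordered l d e j \<le> bordered l d e i"
proof -
  consider "j \<le> d" | "i \<le> d" "j = Suc d" | "i \<le> d" "Suc d < j" | "i = Suc d" "j = i" | "i = Suc d" "i < j"
    | "Suc d < i" using assms by linarith
  then show ?thesis
    using assms l_antimono[of i j] l_antimono_pred[of i j] l_antimono[of i "j - 1"] l_ge_durfee[of i] l_le_durfee_pred[of j]
    by cases (auto simp: bordered_def)
qed

lemma bordered_partition:
  assumes "e = d \<or> e = Suc d"
  shows "is_partition (bordered l d e)"
proof -
  have "{i. bordered l d e i \<noteq> 0} \<subseteq> {..Suc d} \<union> Suc ` {i. l i \<noteq> 0}"
  proof
    fix i assume "i \<in> {i. bordered l d e i \<noteq> 0}"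
    then show "i \<in> {..Suc d} \<union> Suc ` {i. l i \<noteq> 0}"
      by (cases i) (auto simp: bordered_def split: if_splits)
  qed
  moreover have "finite ({..Suc d} \<union> Suc ` {i. l i \<noteq> 0})"
    using partitionD(2)[OF l_partition] by simp
  ultimately have "finite {i. bordered l d e i \<noteq> 0}" by (rule finite_subset)
  then show ?thesis
    using bordered_antimono[OF assms]
    by (simp add: is_partition_def weak_composition_def bordered_def[of l d e 0])
qed

lemma bordered_swap:
  assumes "e = d \<or> e = Suc d" "1 \<le> i" "i < j"
  shows "i \<le> bordered l d e j \<longleftrightarrow> j \<le> bordered l d e i"
proof -
  consider "j \<le> d" | "i \<le> d" "j = Suc d" | "i \<le> d" "Suc d < j" | "i = Suc d" | "Suc d < i"
    using assms by linarith
  then show ?thesis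
    using assms l_swap_pred[of j i] l_ge_durfee[of i] l_ge_durfee[of j]
      l_le_durfee_pred[of j] l_le_durfee_pred[of i]
    by cases (auto simp: bordered_def)
qed

lemma bordered_symmetric:
  assumes "e = d \<or> e = Suc d"
  shows "symmetric_partition (bordered l d e)"
proof (rule symmetric_partitionI[OF bordered_partition[OF assms]])
  fix i j :: nat assume "1 \<le> i" "1 \<le> j"
  then show "i \<le> bordered l d e j \<longleftrightarrow> j \<le> bordered l d e i"
    using bordered_swap[OF assms, of i j] bordered_swap[OF assms, of j i]
    by (cases i j rule: linorder_cases) blast+
qed

lemma half_lt_bordered:
  assumes "e = d \<or> e = Suc d"
  shows "half_lt (bordered l d e) = half_le l"
proof -
  have "bordered l d e i - i = (if i = 0 then 0 else l i - (i - 1))" for i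
  proof -
    consider "i = 0" | "1 \<le> i" "i \<le> d" | "i = Suc d" | "Suc d < i" by linarith
    then show ?thesis
      using assms l_ge_durfee[of i] l_le_durfee[of i] l_le_durfee_pred[of i]
      by cases (auto simp: bordered_def)
  qed
  then show ?thesis
    by (simp add: half_lt_eq[OF bordered_partition[OF assms]] half_le_eq[OF l_partition])
qed

text \<open>
  The old cells are moved apart by the new row and column, which have \<open>d\<close> cells each.
\<close>

lemma diagram_bordered:
  "diagram (bordered l d d)
    = map_prod (\<lambda>i. if i \<le> d then i else Suc i) (\<lambda>i. if i \<le> d then i else Suc i) ` diagram l
      \<union> {Suc d} \<times> {1..d} \<union> {1..d} \<times> {Suc d}" (is "_ = map_prod ?s ?s ` _ \<union> _ \<union> _")
proof (intro equalityI subsetI)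
  fix c assume c: "c \<in> diagram (bordered l d d)"
  obtain i j where ij: "c = (i, j)" by (cases c)
  then have pos: "1 \<le> i" "1 \<le> j" and le: "j \<le> bordered l d d i" using c by (auto simp: diagram_def)
  have preimage: "(i, j) \<in> map_prod ?s ?s ` diagram l"
    if "1 \<le> a" "1 \<le> b" "b \<le> l a" "?s a = i" "?s b = j" for a b
    using that by (intro image_eqI[of _ _ "(a, b)"]) (auto simp: diagram_def)
  consider "i = Suc d" | "j = Suc d" "i \<noteq> Suc d" | "i \<le> d" "j \<le> d" | "i \<le> d" "Suc d < j"
    | "Suc d < i" "j \<noteq> Suc d" by linarith
  then show "c \<in> map_prod ?s ?s ` diagram l \<union> {Suc d} \<times> {1..d} \<union> {1..d} \<times> {Suc d}"
  proof cases
    case 1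
    then show ?thesis using pos le ij by (auto simp: bordered_def)
  next
    case 2
    then have "i \<le> d" using le pos l_le_durfee_pred[of i] by (auto simp: bordered_def split: if_splits)
    then show ?thesis using 2 pos ij by auto
  next
    case 3
    then show ?thesis using preimage[of i j] pos le ij l_ge_durfee[of i] by (auto simp: bordered_def)
  next
    case 4
    then show ?thesis using preimage[of i "j - 1"] pos le ij by (auto simp: bordered_def)
  next
    case 5
    then have "j \<le> l (i - 1)" using le by (simp add: bordered_def)
    moreover have "j \<le> d" using calculation l_le_durfee_pred[of i] 5 by simp
    ultimately show ?thesis using preimage[of "i - 1" j] pos ij 5 by auto
  qed
next
  fix c assume "c \<in> map_prod ?s ?s ` diagram l \<union> {Suc d} \<times> {1..d} \<union> {1..d} \<times> {Suc d}"
  then consider "c \<in> {Suc d} \<times> {1..d} \<union> {1..d} \<times> {Suc d}"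
    | a b where "1 \<le> a" "1 \<le> b" "b \<le> l a" "c = (?s a, ?s b)" by (auto simp: diagram_def)
  then show "c \<in> diagram (bordered l d d)"
  proof cases
    case 1
    then show ?thesis using l_ge_durfee by (auto simp: diagram_def bordered_def)
  next
    case 2
    then show ?thesis
      using l_le_durfee[of a] by (cases "a \<le> d") (auto simp: diagram_def bordered_def)
  qed
qed

lemma diagram_bordered_Suc:
  "diagram (bordered l d (Suc d)) = insert (Suc d, Suc d) (diagram (bordered l d d))"
proof -
  have "bordered l d (Suc d) i = (if i = Suc d then Suc d else bordered l d d i)" for i
    by (simp add: bordered_def)
  moreover have "bordered l d d (Suc d) = d" by (simp add: bordered_def)
  ultimately have "(i, j) \<in> diagram (bordered l d (Suc d))
      \<longleftrightarrow> (i, j) \<in> insert (Suc d, Suc d) (diagram (bordered l d d))" for i j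
    by (cases "i = Suc d") (auto simp: diagram_def)
  then show ?thesis by auto
qed

text \<open>
  The hypothesis says that row \<open>d\<close>, if there is one, is longer than \<open>d\<close>. Then, for
  \<open>e = d\<close>, no diagonal cell is a removable corner, and the addable \<open>(Suc d, Suc d)\<close> has no removable neighbour
  \<open>(Suc d, d)\<close>, because row \<open>Suc (Suc d)\<close> has length \<open>d\<close> too. For \<open>e = Suc d\<close> the corner
  \<open>(Suc d, Suc d)\<close> is removable and the cell to its right can be added.
\<close>

lemma skew_symmetric_bordered:
  assumes "l (Suc d) = d"
  shows "skew_symmetric_partition (bordered l d d)" "\<not> skew_symmetric_partition (bordered l d (Suc d))"
proof -
  have gt: "d < l i" if "1 \<le> i" "i \<le> d" for i
    using l_swap[of i "Suc d"] that assms by simp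
  note iffs = removable_corner_iff[OF bordered_partition] addable_corner_iff[OF bordered_partition]
  show "skew_symmetric_partition (bordered l d d)"
    unfolding skew_symmetric_partition_def
  proof (intro conjI allI impI)
    fix i :: nat assume i: "1 \<le> i"
    have "bordered l d d i \<noteq> i"
      using i gt[of i] l_le_durfee_pred[of i] by (auto simp: bordered_def)
    moreover assume "removable_corner (bordered l d d) (i, i)"
    ultimately show "\<not> addable_corner (bordered l d d) (i, i + 1)" using i by (simp add: iffs)
  next
    fix i :: nat assume i: "1 \<le> i"
    assume "addable_corner (bordered l d d) (i, i)"
    then have "i = Suc (bordered l d d i)" using i by (simp add: iffs)
    moreover have "l (i - 1) \<noteq> i - 1" if "Suc d < i" using l_le_durfee_pred[of i] that by simp
    ultimately have "i = Suc d" using i gt[of i] by (auto simp: bordered_def split: if_splits)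
    then show "\<not> removable_corner (bordered l d d) (i, i - 1)"
      using assms by (simp add: iffs) (simp add: bordered_def)
  qed (rule bordered_symmetric, simp)
  have "removable_corner (bordered l d (Suc d)) (Suc d, Suc d)"
    using assms by (simp add: iffs) (simp add: bordered_def)
  moreover have "addable_corner (bordered l d (Suc d)) (Suc d, Suc d + 1)"
    using gt[of d] by (simp add: iffs) (auto simp: bordered_def)
  ultimately show "\<not> skew_symmetric_partition (bordered l d (Suc d))"
    unfolding skew_symmetric_partition_def by (metis le_add1 plus_1_eq_Suc)
qed

text \<open>
  Now \<open>l d = d\<close>. For \<open>e = Suc d\<close> the rows \<open>d\<close> and \<open>Suc d\<close> have equal length, so nothing can be
  added to the right of the corner \<open>(Suc d, Suc d)\<close>. For \<open>e = d\<close> the cell \<open>(Suc d, Suc d)\<close> is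
  addable and \<open>(Suc d, d)\<close> is removable.
\<close>

lemma skew_symmetric_bordered_Suc:
  assumes "l (Suc d) \<noteq> d"
  shows "skew_symmetric_partition (bordered l d (Suc d))" "\<not> skew_symmetric_partition (bordered l d d)"
proof -
  have lt: "l (Suc d) < d" using l_le_durfee[of "Suc d"] assms by simp
  have ld: "l d = d" using tie_rows[of d] lt by simp
  note iffs = removable_corner_iff[OF bordered_partition] addable_corner_iff[OF bordered_partition]
  show "skew_symmetric_partition (bordered l d (Suc d))"
    unfolding skew_symmetric_partition_def
  proof (intro conjI allI impI)
    fix i :: nat assume i: "1 \<le> i"
    assume "removable_corner (bordered l d (Suc d)) (i, i)"
    then have "bordered l d (Suc d) i = i" using i by (simp add: iffs)
    moreover have "bordered l d (Suc d) i \<noteq> i" if "i \<noteq> Suc d"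
      using i l_ge_durfee[of i] l_le_durfee_pred[of i] that
      by (cases "i \<le> d") (simp_all add: bordered_def)
    ultimately have "i = Suc d" by blast
    then show "\<not> addable_corner (bordered l d (Suc d)) (i, i + 1)"
      using lt ld by (simp add: iffs) (simp add: bordered_def)
  next
    fix i :: nat assume i: "1 \<le> i"
    have "i \<noteq> Suc (bordered l d (Suc d) i)"
    proof -
      consider "i \<le> d" | "i = Suc d" | "i = Suc (Suc d)" | "Suc (Suc d) < i" by linarith
      then show ?thesis
        using i l_ge_durfee[of i] l_le_durfee_pred[of i] lt by cases (auto simp: bordered_def)
    qed
    moreover assume "addable_corner (bordered l d (Suc d)) (i, i)"
    ultimately show "\<not> removable_corner (bordered l d (Suc d)) (i, i - 1)" using i by (simp add: iffs)
  qed (rule bordered_symmetric, simp)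
  have "removable_corner (bordered l d d) (Suc d, Suc d - 1)"
    using lt by (simp add: iffs) (simp add: bordered_def)
  moreover have "addable_corner (bordered l d d) (Suc d, Suc d)"
    using lt ld by (simp add: iffs) (simp add: bordered_def)
  ultimately show "\<not> skew_symmetric_partition (bordered l d d)"
    unfolding skew_symmetric_partition_def by (metis le_add1 plus_1_eq_Suc)
qed

end

section \<open>The bordered weak composition\<close>

lemma symmetric_wc_of_sorter:
  assumes "w \<in> S_inf" "symmetric_partition (\<alpha> \<circ> w)"
  shows "symmetric_wc \<alpha>" "sort_part \<alpha> = \<alpha> \<circ> w"
proof -
  have part: "is_partition (\<alpha> \<circ> w)" by (rule symmetric_partition_is_partition[OF assms(2)])
  show eq: "sort_part \<alpha> = \<alpha> \<circ> w" by (rule sort_part_eqI[OF assms(1) part])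
  show "symmetric_wc \<alpha>"
    unfolding symmetric_wc_def eq using weak_composition_of_sorter[OF assms(1) part] assms(2) by blast
qed

text \<open>
  Here \<open>u\<close> is the sorting permutation of \<open>\<alpha>\<close>, \<open>l\<close> its sorted partition with Durfee size
  \<open>d\<close>, and \<open>v\<close> the part of \<open>u\<close> that is shared with the sorting permutation of \<open>eta \<alpha>\<close>.
\<close>

context
  fixes \<alpha> l :: "nat \<Rightarrow> nat" and d :: nat and u v :: "nat \<Rightarrow> nat"
  assumes wc: "weak_composition \<alpha>"
    and first_zero: "\<alpha> 1 = 0"
    and sym: "symmetric_partition l"
    and durfee_all: "\<forall>i\<ge>1. i \<le> l i \<longleftrightarrow> i \<le> d"
    and u: "u \<in> S_inf" "\<alpha> \<circ> u = l" "stable_on \<alpha> u"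
    and v: "v \<in> S_inf" "v \<circ> cycle (l 1) = u"
begin

lemma length_l: "1 \<le> i \<Longrightarrow> l i \<noteq> 0 \<longleftrightarrow> i \<le> l 1"
  using symmetric_partition_swap[OF sym, of 1 i] by simp linarith

lemma durfee_le_length: "d \<le> l 1"
  using durfee[OF sym durfee_all, of d] length_l[of d] by (cases "d = 0") auto

lemma alpha_u: "\<alpha> (u i) = l i"
  using fun_cong[OF u(2), of i] by simp

lemma u_less:
  assumes "1 \<le> i" "i < j" "l i = l j"
  shows "u i < u j"
proof (rule stable_on_less[OF u(3) _ assms(1,2)])
  show "is_partition (\<alpha> \<circ> u)" unfolding u(2) by (rule symmetric_partition_is_partition[OF sym])
  show "\<alpha> (u i) = \<alpha> (u j)" unfolding alpha_u by (rule assms(3))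
qed

text \<open>
  The index 1 has part 0 and is smaller than all other such indices, so \<open>u\<close> has it as its value
  right behind the nonzero parts, at \<open>Suc (l 1)\<close>.
\<close>

lemma v_first: "v 1 = 1"
proof -
  obtain p where p: "u p = 1" using S_inf_bij[OF u(1)] by (metis bij_pointE)
  have "p \<noteq> 0" using p S_inf_0[OF u(1)] by (cases p) auto
  have "l p = 0" using fun_cong[OF u(2), of p] p first_zero by simp
  then have "l 1 < p" using length_l[of p] \<open>p \<noteq> 0\<close> by simp
  moreover have "\<not> Suc (l 1) < p"
  proof
    assume less: "Suc (l 1) < p"
    then have "u (Suc (l 1)) < u p"
      using length_l[of "Suc (l 1)"] \<open>l p = 0\<close> by (intro u_less) auto
    then show False using p S_inf_pos[OF u(1), of "Suc (l 1)"] by simp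
  qed
  ultimately have "p = Suc (l 1)" by simp
  then show ?thesis using p fun_cong[OF v(2), of p] by (simp add: cycle_apply)
qed

lemma v_shift: "1 \<le> i \<Longrightarrow> i \<le> l 1 \<Longrightarrow> v (Suc i) = u i"
  using fun_cong[OF v(2), of i] by (simp add: cycle_apply)

lemma v_beyond: "Suc (l 1) < i \<Longrightarrow> v i = u i"
  using fun_cong[OF v(2), of i] by (simp add: cycle_apply)

text \<open>
  This is \<open>eta1 \<alpha>\<close> for \<open>e = d\<close> and \<open>eta2 \<alpha>\<close> for \<open>e = Suc d\<close>. In terms of the common part \<open>v\<close>
  of the permutations the new part sits at the index \<open>v 1 = 1\<close>.
\<close>

definition border :: "nat \<Rightarrow> nat \<Rightarrow> nat" where
  "border e = shifted l d e \<circ> inv v"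

lemma border_v: "border e \<circ> v = shifted l d e"
  using S_inf_bij[OF v(1)] by (simp add: border_def comp_assoc bij_is_inj)

lemma border_sorted: "border e \<circ> (v \<circ> cycle d) = bordered l d e"
  by (simp add: border_v shifted_cycle flip: comp_assoc)

lemma border_symmetric:
  assumes "e = d \<or> e = Suc d"
  shows "symmetric_wc (border e)" "sort_part (border e) = bordered l d e"
proof -
  have "symmetric_partition (border e \<circ> (v \<circ> cycle d))"
    unfolding border_sorted using assms by (rule bordered_symmetric[OF sym durfee_all])
  note sorter = symmetric_wc_of_sorter[OF S_inf_comp[OF v(1) cycle_S_inf] this]
  show "symmetric_wc (border e)" by (rule sorter(1))
  show "sort_part (border e) = bordered l d e" using sorter(2) by (simp only: border_sorted)
qed

lemma Dsym_border:
  assumes "e = d \<or> e = Suc d"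
  shows "Dsym (border e) = map_prod (v \<circ> cycle d) (v \<circ> cycle d) ` diagram (bordered l d e)"
proof -
  have "symmetric_partition (border e \<circ> (v \<circ> cycle d))"
    unfolding border_sorted using assms by (rule bordered_symmetric[OF sym durfee_all])
  from Dsym_eq[OF S_inf_comp[OF v(1) cycle_S_inf] this] show ?thesis
    unfolding border_sorted by force
qed

lemma Dsym_eq_image: "Dsym \<alpha> = map_prod u u ` diagram l"
  using Dsym_eq[OF u(1), of \<alpha>] sym unfolding u(2) by force

lemma diagonal_in_Dsym_iff: "(j, j) \<in> Dsym \<alpha> \<longleftrightarrow> j \<in> u ` {1..d}"
proof -
  have "(j, j) \<in> Dsym \<alpha> \<longleftrightarrow> (\<exists>i. j = u i \<and> (i, i) \<in> diagram l)"
    unfolding Dsym_eq_image using S_inf_eq_iff[OF u(1)] by auto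
  also have "\<dots> \<longleftrightarrow> (\<exists>i. j = u i \<and> i \<in> {1..d})"
    using durfee[OF sym durfee_all] by (auto simp: diagram_def)
  finally show ?thesis by auto
qed

lemma diag_eq_durfee: "diag \<alpha> = d"
proof -
  have "{(i, j) \<in> Dsym \<alpha>. i = j} = (\<lambda>j. (j, j)) ` u ` {1..d}"
    using diagonal_in_Dsym_iff by auto
  moreover have "inj_on (\<lambda>j. (j, j)) (u ` {1..d})" "inj_on u {1..d}"
    using S_inf_eq_iff[OF u(1)] by (auto simp: inj_on_def)
  ultimately show ?thesis by (simp add: diag_def card_image)
qed

lemma Dsym_border_d:
  "Dsym (border d) = Dsym \<alpha> \<union> {(i, j). (i = 1 \<and> (j, j) \<in> Dsym \<alpha>) \<or> (j = 1 \<and> (i, i) \<in> Dsym \<alpha>)}"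
proof -
  let ?w = "v \<circ> cycle d" and ?s = "\<lambda>i. if i \<le> d then i else Suc i"
  \<comment> \<open>Row \<open>i\<close> of \<open>l\<close> becomes row \<open>?s i\<close> of the bordered partition and keeps its index \<open>u i\<close>.\<close>
  have w_inner: "?w (?s i) = u i" if "1 \<le> i" "i \<le> l 1" for i
    using that v_shift[of i] by (auto simp: cycle_apply)
  have w_new: "?w (Suc d) = 1" using v_first by (simp add: cycle_apply)
  have w_diag: "?w ` {1..d} = u ` {1..d}"
  proof (intro image_cong refl)
    fix i assume "i \<in> {1..d}"
    then show "?w i = u i" using w_inner[of i] durfee_le_length by simp
  qed
  have "map_prod ?w ?w ` map_prod ?s ?s ` diagram l = map_prod u u ` diagram l"
    unfolding image_image
  proof (intro image_cong refl)
    fix c assume "c \<in> diagram l"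
    then obtain i j where c: "c = (i, j)" "1 \<le> i" "1 \<le> j" "j \<le> l i" by (auto simp: diagram_def)
    then have "l i \<noteq> 0" "i \<le> l j" using symmetric_partition_swap[OF sym, of i j] by auto
    then have "i \<le> l 1" "j \<le> l 1" using length_l[of i] length_l[of j] c by auto
    then show "map_prod ?w ?w (map_prod ?s ?s c) = map_prod u u c"
      using w_inner[of i] w_inner[of j] c by simp
  qed
  moreover have prod_image: "map_prod ?w ?w ` (A \<times> B) = ?w ` A \<times> ?w ` B" for A B
    by (rule map_prod_surj_on) (rule refl)+
  have "map_prod ?w ?w ` ({Suc d} \<times> {1..d}) = {1} \<times> u ` {1..d}"
    "map_prod ?w ?w ` ({1..d} \<times> {Suc d}) = u ` {1..d} \<times> {1}"
    by (simp_all only: prod_image w_diag image_insert image_empty w_new)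
  ultimately have "Dsym (border d) = Dsym \<alpha> \<union> {1} \<times> u ` {1..d} \<union> u ` {1..d} \<times> {1}"
    by (simp only: Dsym_border[OF disjI1[OF refl]] diagram_bordered[OF sym durfee_all] Dsym_eq_image image_Un)
  then show ?thesis using diagonal_in_Dsym_iff by auto
qed

lemma Dsym_border_Suc: "Dsym (border (Suc d)) = Dsym (border d) \<union> {(1, 1)}"
proof -
  have "(v \<circ> cycle d) (Suc d) = 1" using v_first by (simp add: cycle_apply)
  then show ?thesis
    by (simp add: Dsym_border diagram_bordered_Suc[OF sym durfee_all])
qed

lemma eta1_eq: "eta1 \<alpha> = border d"
  unfolding eta1_def
proof (rule the_equality)
  show "symmetric_wc (border d) \<and> Dsym (border d)
    = Dsym \<alpha> \<union> {(i, j). (i = 1 \<and> (j, j) \<in> Dsym \<alpha>) \<or> (j = 1 \<and> (i, i) \<in> Dsym \<alpha>)}"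
    using border_symmetric(1)[of d] Dsym_border_d by blast
next
  fix \<eta> assume "symmetric_wc \<eta> \<and> Dsym \<eta>
    = Dsym \<alpha> \<union> {(i, j). (i = 1 \<and> (j, j) \<in> Dsym \<alpha>) \<or> (j = 1 \<and> (i, i) \<in> Dsym \<alpha>)}"
  then show "\<eta> = border d"
    using border_symmetric(1)[of d] Dsym_border_d unfolding symmetric_wc_def
    by (intro Dsym_inject) simp_all
qed

lemma eta2_eq: "eta2 \<alpha> = border (Suc d)"
  unfolding eta2_def eta1_eq
proof (rule the_equality)
  show "symmetric_wc (border (Suc d)) \<and> Dsym (border (Suc d)) = Dsym (border d) \<union> {(1, 1)}"
    using border_symmetric(1)[of "Suc d"] Dsym_border_Suc by blast
next
  fix \<eta> assume "symmetric_wc \<eta> \<and> Dsym \<eta> = Dsym (border d) \<union> {(1, 1)}"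
  then show "\<eta> = border (Suc d)"
    using border_symmetric(1)[of "Suc d"] Dsym_border_Suc unfolding symmetric_wc_def
    by (intro Dsym_inject) simp_all
qed

lemma skew_symmetric_border:
  assumes "e = d \<or> e = Suc d"
  shows "skew_symmetric_wc (border e) \<longleftrightarrow> skew_symmetric_partition (bordered l d e)"
proof -
  have "weak_composition (border e)"
    using border_symmetric(1)[OF assms] unfolding symmetric_wc_def by blast
  then show ?thesis by (simp only: skew_symmetric_wc_def border_symmetric(2)[OF assms] simp_thms)
qed

lemma eta_eq: "eta \<alpha> = border (if l (Suc d) = d then d else Suc d)"
  unfolding eta_def eta1_eq eta2_eq
proof (rule the_equality)
  note skew = skew_symmetric_bordered[OF sym durfee_all] skew_symmetric_bordered_Suc[OF sym durfee_all]
  show "border (if l (Suc d) = d then d else Suc d) \<in> {border d, border (Suc d)}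
    \<and> skew_symmetric_wc (border (if l (Suc d) = d then d else Suc d))"
    using skew by (auto simp: skew_symmetric_border)
  show "\<eta> = border (if l (Suc d) = d then d else Suc d)"
    if "\<eta> \<in> {border d, border (Suc d)} \<and> skew_symmetric_wc \<eta>" for \<eta>
    using that skew by (auto simp: skew_symmetric_border)
qed

text \<open>
  The skew-symmetric choice of \<open>e\<close> makes this formula uniform. In the case \<open>e = d\<close>, where
  \<open>l (Suc d) = d\<close>, the new part stands behind the first \<open>d\<close>. In the case \<open>e = Suc d\<close> it equals
  the parts that came from rows of length \<open>d\<close> and precedes them, since it has index 1; only the
  \<open>l (Suc d)\<close> rows longer than \<open>d\<close> remain in front of it.
\<close>

lemma sort_perm_border:
  assumes "e = (if l (Suc d) = d then d else Suc d)"
  shows "sort_perm (border e) = v \<circ> cycle (l (Suc d))"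
proof (rule sort_perm_eqI)
  define t where "t = l (Suc d)"
  have e: "e = d \<or> e = Suc d" using assms by simp
  have t: "t \<le> d" unfolding t_def by (rule l_le_durfee[OF sym durfee_all]) simp
  have ties: "l i = d" if "t < i" "i \<le> d" for i
    using that tie_rows[OF sym durfee_all, of i] by (simp add: t_def)
  have long: "d < l i" if "1 \<le> i" "i \<le> t" for i
    using that symmetric_partition_swap[OF sym, of i "Suc d"] by (simp add: t_def Suc_le_eq)
  have sorted: "border e \<circ> (v \<circ> cycle (l (Suc d))) = bordered l d e"
  proof (cases "t = d")
    case True
    then show ?thesis using border_sorted by (simp add: t_def)
  next
    case False
    then show ?thesis
      using shifted_cycle_ties[OF t ties] assms
      by (simp add: border_v t_def flip: comp_assoc)
  qed
  show "weak_composition (border e)" using border_symmetric(1)[OF e] unfolding symmetric_wc_def by blast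
  show S: "v \<circ> cycle (l (Suc d)) \<in> S_inf" by (intro S_inf_comp v cycle_S_inf)
  show "is_partition (border e \<circ> (v \<circ> cycle (l (Suc d))))"
    unfolding sorted using e by (rule bordered_partition[OF sym durfee_all])
  show "stable_on (border e) (v \<circ> cycle (l (Suc d)))"
    unfolding stable_on_def t_def[symmetric]
  proof (intro allI impI)
    fix i :: nat
    assume i: "1 \<le> i" and "border e ((v \<circ> cycle t) i) = border e ((v \<circ> cycle t) (Suc i))"
    then have tie: "bordered l d e i = bordered l d e (Suc i)"
      using fun_cong[OF sorted, of i] fun_cong[OF sorted, of "Suc i"] by (simp add: t_def)
    \<comment> \<open>The cycle only delays the new part: the other indices come in the order in which \<open>u\<close> lists them.\<close>
    have high: "(v \<circ> cycle t) k = u (k - 1)" if "Suc t < k" "k \<le> Suc (l 1)" for k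
      using that v_shift[of "k - 1"] by (auto simp: cycle_apply)
    have low: "(v \<circ> cycle t) k = u k" if "1 \<le> k" "k \<le> t" for k
      using that t durfee_le_length v_shift[of k] by (simp add: cycle_apply)
    consider "i < t" | "i = t" | "i = Suc t" | "Suc t < i" "i \<le> d" | "Suc t < i" "i = Suc d"
      | "Suc d < i" "i \<le> l 1" | "Suc d < i" "i = Suc (l 1)" | "Suc d < i" "Suc (l 1) < i"
      by linarith
    then show "(v \<circ> cycle t) i < (v \<circ> cycle t) (Suc i)"
    proof cases
      case 1
      then show ?thesis using low i tie t u_less[of i "Suc i"] by (simp add: bordered_def)
    next
      case 2
      then have False
        using tie long[of t] ties[of "Suc t"] t i assms by (auto simp: bordered_def t_def split: if_splits)
      then show ?thesis ..
    next
      case 3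
      have "(v \<circ> cycle t) (Suc t) = 1" using v_first by (simp add: cycle_apply)
      moreover have "(v \<circ> cycle t) (Suc (Suc t)) \<noteq> 0" "(v \<circ> cycle t) (Suc (Suc t)) \<noteq> (v \<circ> cycle t) (Suc t)"
        using S_inf_eq_iff[OF S[folded t_def]] S_inf_pos[OF S[folded t_def], of "Suc (Suc t)"] by auto
      ultimately show ?thesis unfolding 3 by linarith
    next
      case 4
      then have "u (i - 1) < u i" using ties[of i] ties[of "i - 1"] by (intro u_less) auto
      then show ?thesis using 4 high[of i] high[of "Suc i"] durfee_le_length by simp
    next
      case 5
      then have False using tie t assms by (auto simp: bordered_def t_def split: if_splits)
      then show ?thesis ..
    next
      case 6
      then have "l (i - 1) = l i" using tie by (simp add: bordered_def)
      then have "u (i - 1) < u i" using 6 by (intro u_less) auto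
      then show ?thesis using 6 t high[of i] high[of "Suc i"] by simp
    next
      case 7
      then have "l (i - 1) = l i" using tie by (simp add: bordered_def)
      then show ?thesis using 7 length_l[of "i - 1"] length_l[of i] by auto
    next
      case 8
      then have "u i < u (Suc i)" using length_l[of i] length_l[of "Suc i"] by (intro u_less) auto
      then show ?thesis using 8 t v_beyond[of i] v_beyond[of "Suc i"] by (simp add: cycle_apply)
    qed
  qed
qed

end

section \<open>Comparison of the two key polynomials\<close>

lemma swap_vars_power_two: "swap_vars k (2 ^ n) = 2 ^ n"
  using swap_vars_of_int[of k "2 ^ n"] by simp

lemma idd_perm_power_two:
  assumes "w \<in> S_inf"
  shows "idd_perm w (2 ^ n * f) = 2 ^ n * idd_perm w f"
proof -
  obtain ks where "reduced_word ks w" using reduced_word_exists assms by blast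
  then show ?thesis
    by (simp only: idd_perm_reduced_word foldr_idd_mult_invariant swap_vars_power_two)
qed

context
  fixes l :: "nat \<Rightarrow> nat" and d :: nat
  assumes sym: "symmetric_partition l"
    and durfee_all: "\<forall>i\<ge>1. i \<le> l i \<longleftrightarrow> i \<le> d"
begin

lemma rows_antimono_all: "\<forall>i j. 1 \<le> i \<and> i \<le> j \<and> j \<le> d \<longrightarrow> l j \<le> l i"
  using l_antimono[OF sym durfee_all] by blast

lemma rows_ge_all: "\<forall>i. 1 \<le> i \<and> i \<le> d \<longrightarrow> d \<le> l i"
  using l_ge_durfee[OF sym durfee_all] by blast

text \<open>
  The rows behind \<open>l (Suc d)\<close> and up to \<open>d\<close> have length \<open>d\<close>, so by \<open>swap_vars_prows\<close> the
  remaining operators act trivially.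
\<close>

lemma idds_prows_ties:
  "foldr idd [1..<Suc d] (prows l d 1) = foldr idd [1..<Suc (l (Suc d))] (prows l d 1)"
proof -
  have le: "l (Suc d) \<le> d" by (rule l_le_durfee[OF sym durfee_all]) simp
  have "foldr idd [Suc (l (Suc d))..<Suc d] (prows l d 1) = prows l d 1"
  proof (rule foldr_idd_invariant)
    fix k assume "k \<in> set [Suc (l (Suc d))..<Suc d]"
    then have "1 \<le> k" "l (Suc d) < k" "k \<le> d" by auto
    then show "swap_vars k (prows l d 1) = prows l d 1"
      using tie_rows[OF sym durfee_all] by (intro swap_vars_prows[OF rows_antimono_all rows_ge_all])
  qed
  moreover have "[1..<Suc d] = [1..<Suc (l (Suc d))] @ [Suc (l (Suc d))..<Suc d]"
    using le upt_add_eq_append[of 1 "Suc (l (Suc d))" "d - l (Suc d)"] by (simp del: upt_Suc)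
  ultimately show ?thesis by (simp only: foldr_append)
qed

lemma idds_Q_eq_idds_P:
  "foldr idd [1..<Suc (l 1)] (\<Prod>(i, j)\<in>diagram (half_le l). X i + X (i + j - 1))
    = 2 ^ d * foldr idd [1..<Suc (l (Suc d))] (\<Prod>(i, j)\<in>diagram (half_le l). X i + X (i + j))"
proof -
  have half: "half_le l i = l i - (i - 1)" if "1 \<le> i" for i
    using half_le_eq[OF l_partition[OF sym durfee_all]] that by simp
  have le: "l i \<le> d" if "d < i" for i by (rule l_le_durfee[OF sym durfee_all that])
  have d_le: "d \<le> l 1" using rows_ge_all by (cases "d = 0") auto
  have "foldr idd [1..<Suc (l 1)] (\<Prod>(i, j)\<in>diagram (half_le l). X i + X (i + j - 1))
      = 2 ^ d * foldr idd [1..<Suc (l 1)] (qrows l d 1)"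
    by (simp only: prod_diagram_eq_qrows[OF rows_antimono_all rows_ge_all half le]
        foldr_idd_mult_invariant swap_vars_power_two)
  also have "foldr idd [1..<Suc (l 1)] (qrows l d 1) = foldr idd [1..<Suc d] (prows l d 1)"
    using d_le by (intro idds_qrows[OF rows_antimono_all rows_ge_all]) simp_all
  also have "\<dots> = foldr idd [1..<Suc (l (Suc d))] (prows l d 1)" by (rule idds_prows_ties)
  finally show ?thesis
    by (simp only: prod_diagram_eq_prows[OF rows_antimono_all rows_ge_all half le])
qed

end

theorem theorem2p48:
  fixes \<alpha> :: "nat \<Rightarrow> nat"
  assumes "symmetric_wc \<alpha>"
    and "\<alpha> 1 = 0"
  shows "kappaQ \<alpha> = 2 ^ diag \<alpha> * kappaP (eta \<alpha>)"
proof -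
  define l u where "l = sort_part \<alpha>" and "u = sort_perm \<alpha>"
  have wc: "weak_composition \<alpha>" and sym: "symmetric_partition l"
    using assms(1) unfolding symmetric_wc_def l_def by blast+
  note u = sort_perm[OF wc, folded l_def u_def]
  obtain d where durfee: "\<forall>i\<ge>1. i \<le> l i \<longleftrightarrow> i \<le> d"
    using durfee_exists[OF u(3)] by blast
  \<comment> \<open>The reversed word represents the inverse of \<open>cycle (l 1)\<close>.\<close>
  define v where "v = u \<circ> word_perm (rev [1..<Suc (l 1)])"
  have v: "v \<in> S_inf"
    unfolding v_def using u(1) by (intro S_inf_comp word_perm_S_inf) (auto simp: is_word_def)
  have vu: "v \<circ> cycle (l 1) = u"
    using word_perm_rev[of "rev [1..<Suc (l 1)]"]
    by (simp only: v_def cycle_def comp_assoc rev_rev_ident comp_id)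
  note setting = wc assms(2) sym durfee u(1) u(2)[symmetric] u(4) v vu
  define e where "e = (if l (Suc d) = d then d else Suc d)"
  have e: "e = d \<or> e = Suc d" by (simp add: e_def)
  define P where "P = (\<Prod>(i, j)\<in>diagram (half_le l). X i + X (i + j))"
  have "kappaP (eta \<alpha>) = idd_perm (v \<circ> cycle (l (Suc d))) P"
    unfolding kappaP_def kappaP_pair_def eta_eq[OF setting, folded e_def]
      sort_perm_border[OF setting e_def] border_symmetric(2)[OF setting e]
      half_lt_bordered[OF sym durfee e] P_def ..
  also have "\<dots> = idd_perm v (foldr idd [1..<Suc (l (Suc d))] P)"
    by (rule idd_perm_cycle[OF v v_first[OF setting]])
  finally have P: "kappaP (eta \<alpha>) = idd_perm v (foldr idd [1..<Suc (l (Suc d))] P)" .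
  have "kappaQ \<alpha> = idd_perm (v \<circ> cycle (l 1)) (\<Prod>(i, j)\<in>diagram (half_le l). X i + X (i + j - 1))"
    unfolding vu unfolding kappaQ_def kappaQ_pair_def l_def u_def ..
  also have "\<dots> = idd_perm v (foldr idd [1..<Suc (l 1)] (\<Prod>(i, j)\<in>diagram (half_le l). X i + X (i + j - 1)))"
    by (rule idd_perm_cycle[OF v v_first[OF setting]])
  also have "\<dots> = idd_perm v (2 ^ d * foldr idd [1..<Suc (l (Suc d))] P)"
    by (simp only: idds_Q_eq_idds_P[OF sym durfee] P_def)
  also have "\<dots> = 2 ^ diag \<alpha> * kappaP (eta \<alpha>)"
    by (simp only: idd_perm_power_two[OF v] P diag_eq_durfee[OF setting])
  finally show ?thesis .
qed

end
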